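(* Let $(B^H_t)_{t\in[0,T]}$ be a fractional Brownian motion with Hurst index $H\in(1/2,1)$, and consider the SDE $$\mathrm{d}X_t=b(t,X_t)\,\mathrm{d}t+\mathrm{d}B^H_t,\quad t\in[0,T],\qquad X_0=x_0\in\mathbb{R},\qquad (\ast)$$ where $b\colon[0,T]\times\mathbb{R}\to\mathbb{R}$ is a measurable function. Then the following assertions hold. (i) If $b(t,x)$ is piecewise uniformly continuous in the variable $x$, with finitely many discontinuity points $a_1,\dots,a_m\in\mathbb{R}$, $m\in\mathbb{N}$, and there is a constant $C$ with $|b(t,x)|\le C(1+|x|)$ for every $x\in\mathbb{R}$, uniformly in $t\in[0,T]$, then there exists a strong solution to $(\ast)$. Moreover, if $b(t,x)$ is in addition non-increasing in $x$ for every $t$, the solution is unique. (ii) If there exist $m\in\mathbb{N}$, countable sets $M_1,\dots,M_m\subset\mathbb{R}$ and functions $f_1,\dots,f_m$ with $f_i\in L^{q_i}(\mathbb{R})$, $q_1,\dots,q_m\in(1,\infty]$, such that $b(t,x)=b(x)=\sum_{i=1}^m f_i(x)\mathbf{1}_{M_i}(x)$ for $x\in\mathbb{R}$, then there exists a strong solution to $(\ast)$. Moreover, if the functions $f_i$ are bounded, the solution is unique. (iii) Let $M\subset\mathbb{R}$ be a set such that $\mathbb{R}\setminus M$ is countable. If $b(x)=\mathbf{1}_M(x)$, $x\in\mathbb{R}$, then $(\ast)$ admits a unique strong solution. More generally, if $b(t,x)=\tilde b(t,x)\mathbf{1}_M(x)$, where $\tilde b$ is a measurable, uniformly bounded function such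 that $(\ast)$ with $b$ replaced by $\tilde b$ admits a unique strong solution, then $(\ast)$ with $b$ also admits a unique strong solution.
   Context: $T\in(0,\infty)$ is fixed. Fractional Brownian motion with Hurst parameter $H$ is the centered Gaussian process with covariance $\mathbb{E}(B^H_tB^H_s)=\frac12(|t|^{2H}+|s|^{2H}-|t-s|^{2H})$. It is represented as $B^H_t=\int_0^tK_H(t,s)\,\mathrm{d}W_s$ with a standard Brownian motion $W$, where for $H\in(1/2,1)$ $$K_H(t,s)=c_H\,s^{1/2-H}\int_s^t u^{H-1/2}(u-s)^{H-3/2}\,\mathrm{d}u\;\mathbf{1}_{[0,t]}(s)$$ with a normalizing constant $c_H>0$ depending only on $H$. The filtration $(\mathcal{A}_t)_{t\in[0,T]}$ is the augmented filtration generated by $W$, satisfying the usual conditions. A strong solution is an $(\mathcal{A}_t)$-adapted process $X$ on the given space with $X_t=x_0+\int_0^t b(s,X_s)\,\mathrm{d}s+B^H_t$, $t\in[0,T]$, almost surely; uniqueness means that any two ($(\mathcal{A}_t)$-adapted) solutions coincide for every $t\in[0,T]$ almost surely. Piecewise uniformly continuous in $x$ with discontinuity points $a_1<\dots<a_m$ means uniformly continuous in $x$ on each of the open intervals $(-\infty,a_1),(a_1,a_2),\dots,(a_m,\infty)$. The $f_i$ are pointwise defined measurable functions. *)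

theory Defs
  imports "HOL-Probability.Probability"
begin

text \<open>All processes are indexed by the reals, but only their values at times in \<open>{0..T}\<close> matter.\<close>

section \<open>Gaussian processes, Brownian motion, fractional Brownian motion\<close>

text \<open>Constants count as (degenerate) Gaussian random variables.\<close>

definition gaussian_rv :: "'a measure \<Rightarrow> ('a \<Rightarrow> real) \<Rightarrow> bool" where
  "gaussian_rv M Y \<longleftrightarrow> Y \<in> borel_measurable M \<and>
     ((\<exists>\<mu>. AE \<omega> in M. Y \<omega> = \<mu>) \<or>
      (\<exists>\<mu> \<sigma>. \<sigma> > 0 \<and> distributed M lborel Y (normal_density \<mu> \<sigma>)))"

definition gaussian_process :: "'a measure \<Rightarrow> real set \<Rightarrow> (real \<Rightarrow> 'a \<Rightarrow> real) \<Rightarrow> bool" where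
  "gaussian_process M I X \<longleftrightarrow>
     (\<forall>J c. finite J \<and> J \<subseteq> I \<longrightarrow> gaussian_rv M (\<lambda>\<omega>. \<Sum>t\<in>J. c t * X t \<omega>))"

definition brownian_motion :: "'a measure \<Rightarrow> real \<Rightarrow> (real \<Rightarrow> 'a \<Rightarrow> real) \<Rightarrow> bool" where
  "brownian_motion M T W \<longleftrightarrow>
     (\<forall>t\<in>{0..T}. W t \<in> borel_measurable M) \<and>
     (AE \<omega> in M. W 0 \<omega> = 0) \<and>
     (\<forall>s t. 0 \<le> s \<and> s < t \<and> t \<le> T \<longrightarrow>
        distributed M lborel (\<lambda>\<omega>. W t \<omega> - W s \<omega>) (normal_density 0 (sqrt (t - s)))) \<and>
     (\<forall>n (p :: nat \<Rightarrow> real). 0 \<le> p 0 \<and> p n \<le> T \<and> (\<forall>i<n. p i \<le> p (Suc i)) \<longrightarrow>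
        prob_space.indep_vars M (\<lambda>_. borel) (\<lambda>i \<omega>. W (p (Suc i)) \<omega> - W (p i) \<omega>) {..<n}) \<and>
     (AE \<omega> in M. continuous_on {0..T} (\<lambda>t. W t \<omega>))"

definition fractional_brownian_motion ::
  "'a measure \<Rightarrow> real \<Rightarrow> real \<Rightarrow> (real \<Rightarrow> 'a \<Rightarrow> real) \<Rightarrow> bool" where
  "fractional_brownian_motion M T H B \<longleftrightarrow>
     gaussian_process M {0..T} B \<and>
     (\<forall>t\<in>{0..T}. (\<integral>\<omega>. B t \<omega> \<partial>M) = 0) \<and>
     (\<forall>s\<in>{0..T}. \<forall>t\<in>{0..T}. (\<integral>\<omega>. B t \<omega> * B s \<omega> \<partial>M) =
        1 / 2 * (\<bar>t\<bar> powr (2 * H) + \<bar>s\<bar> powr (2 * H) - \<bar>t - s\<bar> powr (2 * H))) \<and>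
     (AE \<omega> in M. continuous_on {0..T} (\<lambda>t. B t \<omega>))"

section \<open>Wiener integral and Volterra kernel\<close>

text \<open>
  Wiener integrals of deterministic square integrable functions on \<open>[0, T]\<close>, defined as
  limits in the mean square of the integrals of step functions. The relation determines \<open>Y\<close>
  only up to almost sure equality.
\<close>

definition has_wiener_integral ::
  "'a measure \<Rightarrow> real \<Rightarrow> (real \<Rightarrow> 'a \<Rightarrow> real) \<Rightarrow> (real \<Rightarrow> real) \<Rightarrow> ('a \<Rightarrow> real) \<Rightarrow> bool" where
  "has_wiener_integral M T W f Y \<longleftrightarrow>
     set_borel_measurable lborel {0..T} f \<and>
     set_integrable lborel {0..T} (\<lambda>s. (f s)\<^sup>2) \<and>
     Y \<in> borel_measurable M \<and> integrable M (\<lambda>\<omega>. (Y \<omega>)\<^sup>2) \<and>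
     (\<exists>(n :: nat \<Rightarrow> nat) (p :: nat \<Rightarrow> nat \<Rightarrow> real) (d :: nat \<Rightarrow> nat \<Rightarrow> real).
        (\<forall>k. 0 \<le> p k 0 \<and> p k (n k) \<le> T \<and> (\<forall>i<n k. p k i \<le> p k (Suc i))) \<and>
        (\<lambda>k. LBINT s:{0..T}.
           ((\<Sum>i<n k. d k i * indicator {p k i<..p k (Suc i)} s) - f s)\<^sup>2) \<longlonglongrightarrow> 0 \<and>
        (\<lambda>k. \<integral>\<omega>.
           ((\<Sum>i<n k. d k i * (W (p k (Suc i)) \<omega> - W (p k i) \<omega>)) - Y \<omega>)\<^sup>2 \<partial>M) \<longlonglongrightarrow> 0)"

text \<open>
  \<open>c\<close> is the normalizing constant. It is determined by \<open>H\<close>: if \<open>c > 0\<close> and the Wiener integrals of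
  the kernel form a fractional Brownian motion of Hurst index \<open>H\<close>, then \<open>c\<close> is the reciprocal of the
  \<open>L\<^sup>2\<close>-norm on \<open>[0, 1]\<close> of the kernel at \<open>t = 1\<close> with \<open>c = 1\<close>.
\<close>

definition volterra_kernel :: "real \<Rightarrow> real \<Rightarrow> real \<Rightarrow> real \<Rightarrow> real" where
  "volterra_kernel H c t s =
     c * s powr (1 / 2 - H) *
     (LBINT u:{s..t}. u powr (H - 1 / 2) * (u - s) powr (H - 3 / 2)) * indicator {0..t} s"

section \<open>Augmented filtration and strong solutions\<close>

text \<open>
  On a complete probability space with \<open>W\<close> a Brownian motion this filtration is right-continuous,
  so the usual conditions hold without taking intersections over later times.
\<close>

definition augmented_filtration ::
  "'a measure \<Rightarrow> (real \<Rightarrow> 'a \<Rightarrow> real) \<Rightarrow> real \<Rightarrow> 'a measure" where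
  "augmented_filtration M W t =
     sigma (space M)
       ((\<Union>s\<in>{0..t}. sets (vimage_algebra (space M) (W s) borel)) \<union> null_sets M)"

text \<open>
  Integrability of \<open>s \<mapsto> b(s, X\<^sub>s)\<close> is required explicitly, because the Bochner integral of a
  non-integrable function is 0 by convention.
\<close>

definition strong_solution ::
  "'a measure \<Rightarrow> real \<Rightarrow> (real \<Rightarrow> 'a \<Rightarrow> real) \<Rightarrow> (real \<Rightarrow> 'a \<Rightarrow> real) \<Rightarrow>
   (real \<Rightarrow> real \<Rightarrow> real) \<Rightarrow> real \<Rightarrow> (real \<Rightarrow> 'a \<Rightarrow> real) \<Rightarrow> bool" where
  "strong_solution M T W B b x0 X \<longleftrightarrow>
     (\<forall>t\<in>{0..T}. X t \<in> borel_measurable (augmented_filtration M W t)) \<and>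
     (AE \<omega> in M. set_integrable lborel {0..T} (\<lambda>s. b s (X s \<omega>)) \<and>
        (\<forall>t\<in>{0..T}. X t \<omega> = x0 + (LBINT s:{0..t}. b s (X s \<omega>)) + B t \<omega>))"

definition strong_solution_exists where
  "strong_solution_exists M T W B b x0 \<longleftrightarrow> (\<exists>X. strong_solution M T W B b x0 X)"

definition strong_solutions_unique where
  "strong_solutions_unique M T W B b x0 \<longleftrightarrow>
     (\<forall>X Y. strong_solution M T W B b x0 X \<and> strong_solution M T W B b x0 Y \<longrightarrow>
        (AE \<omega> in M. \<forall>t\<in>{0..T}. X t \<omega> = Y t \<omega>))"

section \<open>Conditions on the drift\<close>

definition drift_measurable :: "real \<Rightarrow> (real \<Rightarrow> real \<Rightarrow> real) \<Rightarrow> bool" where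
  "drift_measurable T b \<longleftrightarrow>
     (\<lambda>(t, x). b t x) \<in> borel_measurable (restrict_space borel {0..T} \<Otimes>\<^sub>M borel)"

text \<open>
  For \<open>i = 0, \<dots>, m\<close> the set below is the \<open>i\<close>-th open interval cut out by
  \<open>a 1 < \<dots> < a m\<close>, i.e. \<open>(-\<infinity>, a 1)\<close>, \<open>(a i, a (i + 1))\<close> or \<open>(a m, \<infinity>)\<close>. Nothing is
  assumed about the values at the points \<open>a i\<close>.
\<close>

definition piecewise_uniformly_continuous :: "nat \<Rightarrow> (nat \<Rightarrow> real) \<Rightarrow> (real \<Rightarrow> real) \<Rightarrow> bool" where
  "piecewise_uniformly_continuous m a g \<longleftrightarrow>
     (\<forall>i\<le>m. uniformly_continuous_on
        {x. (1 \<le> i \<longrightarrow> a i < x) \<and> (i < m \<longrightarrow> x < a (Suc i))} g)"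

definition in_Lq :: "ennreal \<Rightarrow> (real \<Rightarrow> real) \<Rightarrow> bool" where
  "in_Lq q f \<longleftrightarrow> f \<in> borel_measurable lebesgue \<and>
     (if q = \<infinity> then \<exists>K. AE x in lebesgue. \<bar>f x\<bar> \<le> K
      else integrable lebesgue (\<lambda>x. \<bar>f x\<bar> powr enn2real q))"

end

(* Everything rests on one property of the noise: almost surely, every measurable set A of times on
   which the path of B is Lipschitz is Lebesgue null. Indeed, the set of pairs (s, t) with
   |s - t| <= h and |B s - B t| <= K |s - t| has expected area O(h^(2 - H)), because the increment is
   Gaussian with standard deviation |s - t|^H; but a Lipschitz set A contributes at least a multiple
   of h |A|^2, and H < 1.
   A solution with locally bounded drift is B plus a Lipschitz function, so it spends no time at a
   given level, hence none in a given countable set. Changing the drift on a countable set of space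
   points therefore does not change the solutions, which gives (ii) and (iii) without any Girsanov
   transform.
   For existence in (i), the drift is replaced by its sup-convolutions, which are Lipschitz in space,
   decrease, and converge to b at every continuity point. Picard iteration solves the approximating
   equations adaptedly, comparison makes their solutions decrease, and the limit spends no time at
   the discontinuities, so dominated convergence identifies it as a solution. *)

theory Submission
  imports Defs
begin

text \<open>The times at which a solution sits at a level depend on the solution and on the path, so
  an almost sure statement about one fixed time set would not help. The area of near-diagonal pairs
  mentions no set \<open>A\<close>: a single exceptional event therefore serves all Lipschitz sets
  of a path, whatever solution produces them. The rate comes from the boundedness of the Gaussian
  density: a pair at distance r qualifies with probability at most K * r / r powr H, and the strip
  of width h has area of order h. Cauchy-Schwarz over about T / h blocks bounds |A|^2 by a quantity
  whose mean is of order h powr (1 - H). After that, the analysis is done path by path. Adaptedness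
  survives because the solution is an iterated pointwise limit of Picard iterates, each measurable
  with respect to the past. It must not be presupposed that the limit is a solution: the uniform
  Lipschitz bound on the approximations minus the noise passes to the limit and makes its level sets
  null beforehand. That \<open>B\<close> is adapted needs its own argument, since the mean-square
  approximations of a Wiener integral may look beyond the current time.\<close>

section \<open>Integral inequalities\<close>

lemma set_integrable_initial:
  fixes f :: "real \<Rightarrow> real"
  assumes "set_integrable lborel {0..T} f" "t \<in> {0..T}"
  shows "set_integrable lborel {0..t} f"
  using assms by (auto intro: set_integrable_subset)

lemma LBINT_singleton [simp]:
  fixes f :: "real \<Rightarrow> real"
  shows "(LBINT s:{a}. f s) = 0"
  unfolding set_lebesgue_integral_def
  using AE_lborel_singleton[of a] by (intro integral_eq_zero_AE) (auto elim: eventually_mono)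

lemma LBINT_split:
  fixes f :: "real \<Rightarrow> real"
  assumes "set_integrable lborel {0..T} f" "0 \<le> r" "r \<le> t" "t \<le> T"
  shows "(LBINT s:{0..t}. f s) = (LBINT s:{0..r}. f s) + (LBINT s:{r<..t}. f s)"
proof -
  have "{0..t} = {0..r} \<union> {r<..t}" using assms by auto
  moreover have "set_integrable lborel {0..r} f" "set_integrable lborel {r<..t} f"
    using assms by (auto intro: set_integrable_subset)
  ultimately show ?thesis by (auto intro!: set_integral_Un)
qed

lemma continuous_on_LBINT:
  fixes f :: "real \<Rightarrow> real"
  assumes "set_integrable lborel {0..T} f"
  shows "continuous_on {0..T} (\<lambda>t. LBINT s:{0..t}. f s)"
proof -
  have "continuous_on {0..T} (\<lambda>t. integral {0..t} f)"
    using assms by (intro indefinite_integral_continuous_1 set_borel_integral_eq_integral)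
  moreover have "(LBINT s:{0..t}. f s) = integral {0..t} f" if "t \<in> {0..T}" for t
    using set_integrable_initial[OF assms that] by (rule set_borel_integral_eq_integral)
  ultimately show ?thesis by (subst continuous_on_cong[OF refl]) auto
qed

text \<open>The rate \<open>2 * L\<close> makes \<open>L\<close> times this integral at most half of
  \<open>exp (2 * L * t)\<close>. This factor 1/2 drives both the Gronwall bound and the Picard
  contraction.\<close>

lemma LBINT_exp:
  fixes L t :: real
  assumes "0 \<le> t" "0 < L"
  shows "(LBINT s:{0..t}. exp (2 * L * s)) = (exp (2 * L * t) - 1) / (2 * L)"
proof -
  have "(LBINT s:{0..t}. exp (2 * L * s)) = exp (2 * L * t) / (2 * L) - exp (2 * L * 0) / (2 * L)"
    unfolding set_lebesgue_integral_def
    using assms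
    by (intro integral_FTC_Icc)
       (auto intro!: derivative_eq_intros continuous_intros simp flip: has_real_derivative_iff_has_vector_derivative)
  then show ?thesis by (simp add: diff_divide_distrib)
qed

text \<open>The constant is not optimal: it comes from evaluating the hypothesis where
  \<open>u t / exp (2 * L * t)\<close> is maximal.\<close>

lemma gronwall:
  fixes u :: "real \<Rightarrow> real"
  assumes cont: "continuous_on {0..T} u" and L: "0 < L" and A: "0 \<le> A"
    and le: "\<And>t. t \<in> {0..T} \<Longrightarrow> u t \<le> A + L * (LBINT s:{0..t}. u s)"
    and t: "t \<in> {0..T}"
  shows "u t \<le> 2 * A * exp (2 * L * T)"
proof -
  have "compact {0..T}" "{0..T} \<noteq> {}" "continuous_on {0..T} (\<lambda>s. u s / exp (2 * L * s))"
    using t cont by (auto intro!: continuous_intros)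
  from continuous_attains_sup[OF this] obtain r where r: "r \<in> {0..T}"
    and max: "\<And>s. s \<in> {0..T} \<Longrightarrow> u s / exp (2 * L * s) \<le> u r / exp (2 * L * r)" by blast
  define m where "m = u r / exp (2 * L * r)"
  have um: "u s \<le> m * exp (2 * L * s)" if "s \<in> {0..T}" for s
    using max[OF that] by (simp add: m_def divide_le_eq)
  have "m \<le> 2 * A"
  proof (cases "m \<le> 0")
    case False
    have "(LBINT s:{0..r}. u s) \<le> (LBINT s:{0..r}. m * exp (2 * L * s))"
      using r cont um
      by (intro set_integral_mono borel_integrable_atLeastAtMost')
         (auto intro!: continuous_intros intro: continuous_on_subset)
    also have "\<dots> = m * ((exp (2 * L * r) - 1) / (2 * L))"
      using r L by (simp add: LBINT_exp)
    also have "\<dots> \<le> m * (exp (2 * L * r) / (2 * L))"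
      using False L by (intro mult_left_mono divide_right_mono) auto
    finally have "L * (LBINT s:{0..r}. u s) \<le> L * (m * (exp (2 * L * r) / (2 * L)))"
      using L by (intro mult_left_mono) auto
    then have "u r \<le> A + m * exp (2 * L * r) / 2"
      using le[OF r] L by simp
    moreover have "u r = m * exp (2 * L * r)" by (simp add: m_def)
    ultimately have "m * exp (2 * L * r) \<le> 2 * A" by linarith
    moreover have "m * 1 \<le> m * exp (2 * L * r)"
      using False L r by (intro mult_left_mono) auto
    ultimately show ?thesis by linarith
  qed (use A in simp)
  then have "u t \<le> 2 * A * exp (2 * L * t)"
    using um[OF t] by (meson exp_ge_zero mult_right_mono order_trans)
  also have "\<dots> \<le> 2 * A * exp (2 * L * T)"
    using A L t by (intro mult_left_mono) auto
  finally show ?thesis .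
qed

text \<open>Gronwall with \<open>A = 0\<close> for the positive part of \<open>D\<close>. Since
  \<delta> is controlled only where \<open>D\<close> is positive, the estimate starts at the last
  time at which \<open>D\<close> was not positive. It serves both the monotonicity of the
  approximations and uniqueness for non-increasing drifts.\<close>

lemma comparison:
  fixes D \<delta> :: "real \<Rightarrow> real"
  assumes int: "set_integrable lborel {0..T} \<delta>" and L: "0 < L"
    and D: "\<And>t. t \<in> {0..T} \<Longrightarrow> D t = (LBINT s:{0..t}. \<delta> s)"
    and le: "\<And>s. s \<in> {0..T} \<Longrightarrow> D s > 0 \<Longrightarrow> \<delta> s \<le> L * D s"
    and t: "t \<in> {0..T}"
  shows "D t \<le> 0"
proof -
  have cont: "continuous_on {0..T} D"
    using continuous_on_LBINT[OF int] by (subst continuous_on_cong[OF refl D])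
  define u where "u = (\<lambda>s. max (D s) 0)"
  have contu: "continuous_on {0..T} u" unfolding u_def using cont by (intro continuous_intros)
  have intu: "set_integrable lborel {0..T} (\<lambda>s. L * u s)"
    by (intro borel_integrable_atLeastAtMost' continuous_intros contu)
  have "u t \<le> 2 * 0 * exp (2 * L * T)"
  proof (rule gronwall[OF contu L _ _ t])
    fix t assume t: "t \<in> {0..T}"
    have nonneg: "0 \<le> (LBINT s:I. L * u s)" for I :: "real set"
      using L unfolding set_lebesgue_integral_def u_def by (intro Bochner_Integration.integral_nonneg) auto
    show "u t \<le> 0 + L * (LBINT s:{0..t}. u s)"
    proof (cases "D t \<le> 0")
      case True then show ?thesis using nonneg[of "{0..t}"] by (simp add: u_def)
    next
      case False
      \<comment> \<open>\<open>Z\<close> is compact and contains 0 because \<open>D 0 = 0\<close>;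
        its maximum \<open>r\<close> is the last time with \<open>D r \<le> 0\<close>, so the part
        of the integral before \<open>r\<close> contributes nothing positive.\<close>
      define Z where "Z = {s \<in> {0..t}. D s \<le> 0}"
      have ct: "continuous_on {0..t} D" using cont t by (auto intro: continuous_on_subset)
      have "Z = {0..t} \<inter> D -` {..0}" by (auto simp: Z_def)
      then have "closed Z"
        using continuous_closed_preimage[OF ct closed_atLeastAtMost closed_atMost] by simp
      then have "compact Z"
        by (auto simp: compact_eq_bounded_closed Z_def intro: bounded_subset[of "{0..t}"])
      moreover have "0 \<in> Z" using t D[of 0] unfolding Z_def
        by auto
      ultimately obtain r where r: "r \<in> Z" "\<And>s. s \<in> Z \<Longrightarrow> s \<le> r"
        using compact_attains_sup[of Z] by blast
      have pos: "D s > 0" if "s \<in> {r<..t}" for s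
        using r(2)[of s] that r(1) by (force simp: Z_def)
      have "D t = D r + (LBINT s:{r<..t}. \<delta> s)"
        using LBINT_split[OF int, of r t] r(1) t D by (auto simp: Z_def)
      also have "\<dots> \<le> (LBINT s:{r<..t}. \<delta> s)" using r(1) by (simp add: Z_def)
      also have "\<dots> \<le> (LBINT s:{r<..t}. L * u s)"
      proof (rule set_integral_mono)
        show "set_integrable lborel {r<..t} \<delta>" "set_integrable lborel {r<..t} (\<lambda>s. L * u s)"
          using r(1) t by (auto intro: set_integrable_subset[OF int] set_integrable_subset[OF intu] simp: Z_def)
        show "\<delta> s \<le> L * u s" if "s \<in> {r<..t}" for s
          using le[of s] pos[OF that] that r(1) t by (auto simp: u_def Z_def)
      qed
      also have "\<dots> \<le> (LBINT s:{0..t}. L * u s)"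
        using LBINT_split[OF intu, of r t] r(1) t nonneg[of "{0..r}"] by (auto simp: Z_def)
      finally show ?thesis using False by (simp add: u_def)
    qed
  qed simp
  then show ?thesis by (simp add: u_def)
qed


lemma LBINT_diff_le:
  fixes f :: "real \<Rightarrow> real"
  assumes f: "set_integrable lborel {0..T} f" and rt: "0 \<le> r" "r \<le> t" "t \<le> T"
    and K: "\<And>s. s \<in> {0..T} \<Longrightarrow> \<bar>f s\<bar> \<le> K"
  shows "\<bar>(LBINT s:{0..t}. f s) - (LBINT s:{0..r}. f s)\<bar> \<le> K * (t - r)"
proof -
  have sub: "set_integrable lborel {r<..t} f" using f rt by (auto intro: set_integrable_subset)
  have c: "set_integrable lborel {r<..t} (\<lambda>s. k)" "(LBINT s:{r<..t}. k) = k * (t - r)" for k :: real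
    using rt by (auto simp: set_integrable_def set_lebesgue_integral_def)
  have K': "f s \<le> K" "- K \<le> f s" if "s \<in> {r<..t}" for s
    using K[of s] that rt by auto
  have "(LBINT s:{r<..t}. f s) \<le> (LBINT s:{r<..t}. K)"
    by (intro set_integral_mono sub c K')
  moreover have "(LBINT s:{r<..t}. - K) \<le> (LBINT s:{r<..t}. f s)"
    by (intro set_integral_mono sub c K')
  ultimately have "\<bar>LBINT s:{r<..t}. f s\<bar> \<le> K * (t - r)"
    unfolding c by simp
  then show ?thesis using LBINT_split[OF f rt] by simp
qed

lemma LBINT_abs_le:
  fixes f :: "real \<Rightarrow> real"
  assumes f: "set_integrable lborel {0..T} f" and t: "t \<in> {0..T}"
    and K: "\<And>s. s \<in> {0..T} \<Longrightarrow> \<bar>f s\<bar> \<le> K"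
  shows "\<bar>LBINT s:{0..t}. f s\<bar> \<le> K * t"
  using LBINT_diff_le[OF f _ _ _ K, of 0 t] t by auto

section \<open>The drift evaluated along a continuous path\<close>

lemma set_borel_measurable_along_path:
  fixes b :: "real \<Rightarrow> real \<Rightarrow> real"
  assumes [measurable]: "case_prod b \<in> borel_measurable (borel \<Otimes>\<^sub>M borel)"
    and y: "continuous_on {0..T} y"
  shows "set_borel_measurable lborel {0..T::real} (\<lambda>s. b s (y s) :: real)"
proof -
  have [measurable]: "(\<lambda>s. indicator {0..T} s *\<^sub>R y s) \<in> borel_measurable borel"
    by (rule borel_measurable_continuous_on_indicator[OF _ y]) simp
  \<comment> \<open>Nothing is known about \<open>y\<close> outside \<open>{0..T}\<close>, so the
    path is truncated inside \<open>b\<close> as well; the outer indicator hides this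
    change.\<close>
  have "(\<lambda>s. indicator {0..T} s *\<^sub>R b s (indicator {0..T} s *\<^sub>R y s)) \<in> borel_measurable lborel"
    by measurable
  also have "(\<lambda>s. indicator {0..T} s *\<^sub>R b s (indicator {0..T} s *\<^sub>R y s))
    = (\<lambda>s. indicator {0..T} s *\<^sub>R b s (y s))"
    by (auto simp: indicator_def)
  finally show ?thesis by (simp add: set_borel_measurable_def)
qed

lemma set_integrable_along_path:
  assumes b: "case_prod b \<in> borel_measurable (borel \<Otimes>\<^sub>M borel)"
    and growth: "\<And>s x. \<bar>b s x\<bar> \<le> C * (1 + \<bar>x\<bar>)"
    and y: "continuous_on {0..T} y"
  shows "set_integrable lborel {0..T::real} (\<lambda>s. b s (y s) :: real)"
proof (rule set_integrable_bound)
  show "set_integrable lborel {0..T} (\<lambda>s. C * (1 + \<bar>y s\<bar>))"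
    by (intro borel_integrable_atLeastAtMost' continuous_intros y)
  show "set_borel_measurable lborel {0..T} (\<lambda>s. b s (y s))"
    by (rule set_borel_measurable_along_path[OF b y])
  show "AE s in lborel. s \<in> {0..T} \<longrightarrow> norm (b s (y s)) \<le> norm (C * (1 + \<bar>y s\<bar>))"
    using growth by (auto intro: order_trans[OF _ abs_ge_self])
qed

section \<open>Picard iteration\<close>

text \<open>The iteration acts on one path at a time; \<open>w\<close> is the noise with the initial
  value added. Explicit iterates, rather than an abstract fixed point, make the solution visibly
  measurable in the path.\<close>

fun picard :: "(real \<Rightarrow> real \<Rightarrow> real) \<Rightarrow> (real \<Rightarrow> real) \<Rightarrow> nat \<Rightarrow> real \<Rightarrow> real" where
  "picard b w 0 = w"
| "picard b w (Suc k) = (\<lambda>t. w t + (LBINT s:{0..t}. b s (picard b w k s)))"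

declare picard.simps(2) [simp del]

lemma continuous_on_picard:
  assumes "case_prod b \<in> borel_measurable (borel \<Otimes>\<^sub>M borel)"
    and "\<And>s x. \<bar>b s x\<bar> \<le> C * (1 + \<bar>x\<bar>)" and "continuous_on {0..T} w"
  shows "continuous_on {0..T} (picard b w k)"
proof (induction k)
  case (Suc k)
  show ?case
    unfolding picard.simps
    by (intro continuous_on_add continuous_on_LBINT set_integrable_along_path[OF assms(1,2) Suc] assms(3))
qed (use assms in simp)

text \<open>Contraction in the supremum norm weighted by \<open>exp (2 * L * t)\<close>: the
  Lipschitz bound and the integral of the weight give a factor 1/2 per step, on all of
  \<open>{0..T}\<close> at once instead of on short intervals.\<close>

lemma picard_increment_le:
  assumes b: "case_prod b \<in> borel_measurable (borel \<Otimes>\<^sub>M borel)"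
    and growth: "\<And>s x. \<bar>b s x\<bar> \<le> C * (1 + \<bar>x\<bar>)" and w: "continuous_on {0..T} w"
    and lip: "\<And>s x y. \<bar>b s x - b s y\<bar> \<le> L * \<bar>x - y\<bar>" and L: "0 < L"
    and E: "\<And>t. t \<in> {0..T} \<Longrightarrow> \<bar>LBINT s:{0..t}. b s (w s)\<bar> \<le> E"
    and t: "t \<in> {0..T}"
  shows "\<bar>picard b w (Suc k) t - picard b w k t\<bar> \<le> E * (1 / 2) ^ k * exp (2 * L * t)"
  using t
proof (induction k arbitrary: t)
  case 0
  have "\<bar>picard b w (Suc 0) t - picard b w 0 t\<bar> \<le> E * 1" using E 0 by (simp add: picard.simps(2))
  also have "\<dots> \<le> E * exp (2 * L * t)"
    using 0 L E[OF 0] by (intro mult_left_mono) auto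
  finally show ?case by simp
next
  case (Suc k)
  let ?P = "picard b w" and ?E = "E * (1 / 2) ^ k"
  have int: "set_integrable lborel {0..t} (\<lambda>s. b s (?P j s))" for j
    by (rule set_integrable_initial[OF _ Suc.prems], rule set_integrable_along_path[OF b growth])
       (rule continuous_on_picard[OF b growth w])
  have E0: "0 \<le> ?E" using E[OF Suc.prems] by auto
  have diff: "?P (Suc (Suc k)) t - ?P (Suc k) t = (LBINT s:{0..t}. b s (?P (Suc k) s) - b s (?P k s))"
    by (subst set_integral_diff(2)[OF int int]) (simp add: picard.simps(2)[of _ _ "Suc k"] picard.simps(2)[of b w k])
  have "\<bar>?P (Suc (Suc k)) t - ?P (Suc k) t\<bar> \<le> (LBINT s:{0..t}. \<bar>b s (?P (Suc k) s) - b s (?P k s)\<bar>)"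
    unfolding diff
    by (rule set_integral_norm_bound[OF set_integral_diff(1)[OF int[of "Suc k"] int[of k]], unfolded real_norm_def])
  also have "\<dots> \<le> (LBINT s:{0..t}. L * ?E * exp (2 * L * s))"
  proof (rule set_integral_mono)
    show "set_integrable lborel {0..t} (\<lambda>s. \<bar>b s (?P (Suc k) s) - b s (?P k s)\<bar>)"
      by (intro set_integrable_abs set_integral_diff(1) int)
    show "set_integrable lborel {0..t} (\<lambda>s. L * ?E * exp (2 * L * s))"
      by (intro borel_integrable_atLeastAtMost' continuous_intros)
    fix s assume "s \<in> {0..t}"
    then have "L * \<bar>?P (Suc k) s - ?P k s\<bar> \<le> L * (?E * exp (2 * L * s))"
      using Suc L by (intro mult_left_mono) auto
    then show "\<bar>b s (?P (Suc k) s) - b s (?P k s)\<bar> \<le> L * ?E * exp (2 * L * s)"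
      using lip[of s "?P (Suc k) s" "?P k s"] by simp
  qed
  also have "\<dots> = L * ?E * ((exp (2 * L * t) - 1) / (2 * L))"
    using Suc.prems L by (subst set_integral_mult_right) (simp add: LBINT_exp)
  also have "\<dots> = ?E * (1 / 2) * (exp (2 * L * t) - 1)" using L by (simp add: field_simps)
  also have "\<dots> \<le> ?E * (1 / 2) * exp (2 * L * t)" using E0 by (intro mult_left_mono) auto
  finally show ?case by simp
qed

lemma picard_converges:
  assumes b: "case_prod b \<in> borel_measurable (borel \<Otimes>\<^sub>M borel)"
    and growth: "\<And>s x. \<bar>b s x\<bar> \<le> C * (1 + \<bar>x\<bar>)" and w: "continuous_on {0..T} w"
    and lip: "\<And>s x y. \<bar>b s x - b s y\<bar> \<le> L * \<bar>x - y\<bar>" and L: "0 < L" and T: "0 \<le> T"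
  obtains y where "continuous_on {0..T} y"
    "\<And>t. t \<in> {0..T} \<Longrightarrow> (\<lambda>k. picard b w k t) \<longlonglongrightarrow> y t"
    "\<And>t. t \<in> {0..T} \<Longrightarrow> y t = w t + (LBINT s:{0..t}. b s (y s))"
proof -
  let ?P = "picard b w"
  note contP = continuous_on_picard[OF b growth w]
  have int: "set_integrable lborel {0..T} (\<lambda>s. b s (z s))" if "continuous_on {0..T} z" for z
    by (rule set_integrable_along_path[OF b growth that])
  have "bounded ((\<lambda>t. LBINT s:{0..t}. b s (w s)) ` {0..T})"
    by (intro compact_imp_bounded compact_continuous_image continuous_on_LBINT int w) simp
  then obtain E where E: "\<And>t. t \<in> {0..T} \<Longrightarrow> \<bar>LBINT s:{0..t}. b s (w s)\<bar> \<le> E"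
    unfolding bounded_iff by force
  have E0: "0 \<le> E" using E[of 0] T by auto
  \<comment> \<open>The limit is the telescoping series of the increments, whose geometric majorant
    gives uniform convergence by the Weierstrass test.\<close>
  define y where "y t = w t + (\<Sum>j. ?P (Suc j) t - ?P j t)" for t
  have "uniform_limit {0..T} (\<lambda>k t. \<Sum>j<k. ?P (Suc j) t - ?P j t) (\<lambda>t. \<Sum>j. ?P (Suc j) t - ?P j t) sequentially"
  proof (rule Weierstrass_m_test)
    fix k t assume t: "t \<in> {0..T}"
    have "\<bar>?P (Suc k) t - ?P k t\<bar> \<le> E * (1 / 2) ^ k * exp (2 * L * t)"
      by (rule picard_increment_le[OF b growth w lip L E t])
    also have "\<dots> \<le> E * (1 / 2) ^ k * exp (2 * L * T)"
      using E0 L t by (intro mult_left_mono) auto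
    finally show "norm (?P (Suc k) t - ?P k t) \<le> E * (1 / 2) ^ k * exp (2 * L * T)" by simp
  qed (rule summable_mult2, rule summable_mult, rule summable_geometric, simp)
  then have "uniform_limit {0..T} (\<lambda>k t. w t + (\<Sum>j<k. ?P (Suc j) t - ?P j t)) y sequentially"
    unfolding y_def by (rule uniform_limit_add[OF uniform_limit_const])
  also have "(\<lambda>k t. w t + (\<Sum>j<k. ?P (Suc j) t - ?P j t)) = ?P"
    by (intro ext, subst sum_lessThan_telescope) simp
  finally have lim: "uniform_limit {0..T} ?P y sequentially" .
  have conty: "continuous_on {0..T} y"
    by (rule uniform_limit_theorem[OF always_eventually lim]) (use contP in auto)
  have ptw: "(\<lambda>k. ?P k t) \<longlonglongrightarrow> y t" if "t \<in> {0..T}" for t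
    using lim that by (rule tendsto_uniform_limitI)
  have "y t = w t + (LBINT s:{0..t}. b s (y s))" if t: "t \<in> {0..T}" for t
  proof (rule LIMSEQ_unique)
    show "(\<lambda>k. ?P (Suc k) t) \<longlonglongrightarrow> y t"
      using ptw[OF t] by (rule LIMSEQ_Suc)
    have "(\<lambda>k. LBINT s:{0..t}. b s (?P k s)) \<longlonglongrightarrow> (LBINT s:{0..t}. b s (y s))"
    proof (rule LIMSEQ_I)
      fix r :: real assume r: "0 < r"
      \<comment> \<open>With \<open>T + 1\<close> in place of \<open>T\<close> the denominator stays
        positive for \<open>T = 0\<close> and the final bound is strict.\<close>
      define e where "e = r / (L * (T + 1))"
      have e: "0 < e" using r L T by (auto simp: e_def)
      obtain N where N: "\<And>k s. k \<ge> N \<Longrightarrow> s \<in> {0..T} \<Longrightarrow> dist (?P k s) (y s) < e"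
        using uniform_limitD[OF lim e] unfolding eventually_sequentially by blast
      have "norm ((LBINT s:{0..t}. b s (?P k s)) - (LBINT s:{0..t}. b s (y s))) < r" if k: "k \<ge> N" for k
      proof -
        note ik = int[OF contP] int[OF conty]
        have "(LBINT s:{0..t}. b s (?P k s)) - (LBINT s:{0..t}. b s (y s))
          = (LBINT s:{0..t}. b s (?P k s) - b s (y s))"
          using ik by (intro set_integral_diff(2)[symmetric] set_integrable_initial[OF _ t])
        also have "\<bar>\<dots>\<bar> \<le> L * e * t"
        proof (rule LBINT_abs_le[OF set_integral_diff(1)[OF ik] t])
          fix s assume s: "s \<in> {0..T}"
          have "L * \<bar>?P k s - y s\<bar> \<le> L * e"
            using N[OF k s] L by (intro mult_left_mono) (auto simp: dist_real_def)
          then show "\<bar>b s (?P k s) - b s (y s)\<bar> \<le> L * e" using lip[of s "?P k s" "y s"] by simp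
        qed
        also have "\<dots> < L * e * (T + 1)" using L e t by (intro mult_strict_left_mono) auto
        also have "\<dots> = r" using L T by (simp add: e_def)
        finally show ?thesis by simp
      qed
      then show "\<exists>N. \<forall>k\<ge>N. norm ((LBINT s:{0..t}. b s (?P k s)) - (LBINT s:{0..t}. b s (y s))) < r" by blast
    qed
    then show "(\<lambda>k. ?P (Suc k) t) \<longlonglongrightarrow> w t + (LBINT s:{0..t}. b s (y s))"
      unfolding picard.simps(2) by (rule tendsto_add[OF tendsto_const])
  qed
  with conty ptw show ?thesis using that by blast
qed

section \<open>Paths without large Lipschitz sets\<close>

text \<open>Almost every path of a fractional Brownian motion with \<open>H < 1\<close> has this property. It is the
  only feature of the noise, besides continuity and adaptedness, that enters below.\<close>

definition null_lipschitz_sets :: "real \<Rightarrow> (real \<Rightarrow> real) \<Rightarrow> bool" where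
  "null_lipschitz_sets T z \<longleftrightarrow> (\<forall>K. \<forall>A\<in>sets lborel. A \<subseteq> {0..T} \<longrightarrow>
     (\<forall>s\<in>A. \<forall>t\<in>A. \<bar>z s - z t\<bar> \<le> K * \<bar>s - t\<bar>) \<longrightarrow> A \<in> null_sets lborel)"

text \<open>Only increments enter the property, so it passes between versions of the noise and from
  the noise to the noise shifted by the initial value.\<close>

lemma null_lipschitz_sets_cong:
  assumes z: "null_lipschitz_sets T z"
    and eq: "\<And>s t. s \<in> {0..T} \<Longrightarrow> t \<in> {0..T} \<Longrightarrow> z' s - z' t = z s - z t"
  shows "null_lipschitz_sets T z'"
  unfolding null_lipschitz_sets_def
proof (intro allI ballI impI)
  fix K and A :: "real set"
  assume A: "A \<in> sets lborel" "A \<subseteq> {0..T}" and lip: "\<forall>s\<in>A. \<forall>t\<in>A. \<bar>z' s - z' t\<bar> \<le> K * \<bar>s - t\<bar>"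
  have "\<bar>z s - z t\<bar> \<le> K * \<bar>s - t\<bar>" if st: "s \<in> A" "t \<in> A" for s t
  proof -
    have "s \<in> {0..T}" "t \<in> {0..T}" using A(2) st by blast+
    then show ?thesis using bspec[OF bspec[OF lip st(1)] st(2)] by (simp add: eq)
  qed
  then show "A \<in> null_sets lborel" using z A unfolding null_lipschitz_sets_def by blast
qed

text \<open>On a level set \<open>y\<close> is constant, so there the increments of \<open>z\<close>
  are, up to sign, those of the Lipschitz function \<open>y - z\<close>: the level set is a
  Lipschitz set of \<open>z\<close>.\<close>

lemma level_set_null:
  assumes z: "null_lipschitz_sets T z" and y: "continuous_on {0..T} y"
    and lip: "\<forall>s\<in>{0..T}. \<forall>t\<in>{0..T}. \<bar>(y t - z t) - (y s - z s)\<bar> \<le> K * \<bar>t - s\<bar>"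
  shows "{t \<in> {0..T}. y t = a} \<in> null_sets lborel"
proof -
  have "{t \<in> {0..T}. y t = a} = {0..T} \<inter> y -` {a}" by auto
  then have "closed {t \<in> {0..T}. y t = a}"
    using continuous_closed_preimage[OF y closed_atLeastAtMost closed_singleton] by simp
  then have "{t \<in> {0..T}. y t = a} \<in> sets lborel" by simp
  moreover have "\<bar>z s - z t\<bar> \<le> K * \<bar>s - t\<bar>"
    if "s \<in> {t \<in> {0..T}. y t = a}" "t \<in> {t \<in> {0..T}. y t = a}" for s t
  proof -
    have "\<bar>(y t - z t) - (y s - z s)\<bar> \<le> K * \<bar>t - s\<bar>" using lip that by blast
    moreover have "(y t - z t) - (y s - z s) = z s - z t" using that by simp
    ultimately show ?thesis by (simp only: abs_minus_commute[of s t])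
  qed
  ultimately show ?thesis
    using z[unfolded null_lipschitz_sets_def, rule_format, of "{t \<in> {0..T}. y t = a}" K] by blast
qed

section \<open>Monotone approximation of the drift\<close>

text \<open>The supremum runs over the rationals only, to keep joint measurability. At a discontinuity of
  \<open>b s\<close> the function need not dominate \<open>b s\<close>; this is harmless, because solutions spend no time there.\<close>

definition sup_conv :: "(real \<Rightarrow> real \<Rightarrow> real) \<Rightarrow> real \<Rightarrow> real \<Rightarrow> real \<Rightarrow> real" where
  "sup_conv b L s x = (SUP q::rat. b s (of_rat q) - L * \<bar>x - of_rat q\<bar>)"

context
  fixes b :: "real \<Rightarrow> real \<Rightarrow> real" and C :: real
  assumes growth: "\<And>s x. \<bar>b s x\<bar> \<le> C * (1 + \<bar>x\<bar>)" and C: "0 \<le> C"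
begin

text \<open>Replacing \<open>x\<close> by \<open>y\<close> raises the growth bound by at most
  \<open>C * \<bar>x - y\<bar>\<close>, which a penalty of slope at least \<open>C\<close> absorbs.
  This is why all slopes below start at \<open>C\<close>.\<close>

lemma sup_conv_term_le:
  assumes "C \<le> L"
  shows "b s y - L * \<bar>x - y\<bar> \<le> C * (1 + \<bar>x\<bar>)"
proof -
  have "C * \<bar>y\<bar> \<le> C * (\<bar>x\<bar> + \<bar>x - y\<bar>)" using C by (intro mult_left_mono) auto
  moreover have "C * \<bar>x - y\<bar> \<le> L * \<bar>x - y\<bar>" using assms by (intro mult_right_mono) auto
  ultimately show ?thesis using growth[of s y] by (simp add: algebra_simps)
qed

lemma bdd_above_sup_conv:
  "C \<le> L \<Longrightarrow> bdd_above (range (\<lambda>q::rat. b s (of_rat q) - L * \<bar>x - of_rat q\<bar>))"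
  using sup_conv_term_le by (intro bdd_aboveI2)

lemma sup_conv_upper:
  "C \<le> L \<Longrightarrow> b s (of_rat q) - L * \<bar>x - of_rat q\<bar> \<le> sup_conv b L s x"
  unfolding sup_conv_def by (rule cSUP_upper[OF UNIV_I bdd_above_sup_conv])

lemma sup_conv_lipschitz:
  assumes "C \<le> L"
  shows "\<bar>sup_conv b L s x - sup_conv b L s y\<bar> \<le> L * \<bar>x - y\<bar>"
proof -
  have "sup_conv b L s x \<le> sup_conv b L s y + L * \<bar>x - y\<bar>" for x y
    unfolding sup_conv_def[of b L s x]
  proof (rule cSUP_least)
    fix q :: rat
    have "L * \<bar>y - of_rat q\<bar> \<le> L * (\<bar>x - of_rat q\<bar> + \<bar>x - y\<bar>)"
      using C assms by (intro mult_left_mono) auto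
    then show "b s (of_rat q) - L * \<bar>x - of_rat q\<bar> \<le> sup_conv b L s y + L * \<bar>x - y\<bar>"
      using sup_conv_upper[OF assms, of s q y] by (simp add: algebra_simps)
  qed simp
  from this[of x y] this[of y x] show ?thesis by (simp add: abs_minus_commute)
qed

lemma sup_conv_antimono:
  assumes "C \<le> L" "L \<le> L'"
  shows "sup_conv b L' s x \<le> sup_conv b L s x"
  unfolding sup_conv_def[of b L']
proof (rule cSUP_least)
  fix q :: rat
  have "L * \<bar>x - of_rat q\<bar> \<le> L' * \<bar>x - of_rat q\<bar>" using assms by (intro mult_right_mono) auto
  then show "b s (of_rat q) - L' * \<bar>x - of_rat q\<bar> \<le> sup_conv b L s x"
    using sup_conv_upper[OF assms(1), of s q x] by simp
qed simp

text \<open>The growth constant does not deteriorate with \<open>L\<close>, which gives bounds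
  uniform over the approximations. Below, \<open>x\<close> itself may be irrational and no
  continuity is available, so the growth bound is used at rationals tending to
  \<open>x\<close>.\<close>

lemma abs_sup_conv_le:
  assumes "C \<le> L"
  shows "\<bar>sup_conv b L s x\<bar> \<le> C * (1 + \<bar>x\<bar>)"
proof -
  have "sup_conv b L s x \<le> C * (1 + \<bar>x\<bar>)"
    unfolding sup_conv_def using sup_conv_term_le[OF assms] by (intro cSUP_least) auto
  moreover have "- (C * (1 + \<bar>x\<bar>)) \<le> sup_conv b L s x"
  proof (rule field_le_epsilon)
    fix e :: real assume "0 < e"
    \<comment> \<open>A rational within \<open>d\<close> of \<open>x\<close> costs at most
      \<open>L * d\<close> in the penalty and \<open>C * d\<close> in the growth bound; the summand
      1 keeps the denominator positive.\<close>
    define d where "d = e / (C + L + 1)"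
    have d: "0 < d" using \<open>0 < e\<close> assms C by (simp add: d_def)
    then obtain q where q: "x - d < of_rat q" "of_rat q < x"
      using of_rat_dense[of "x - d" x] by auto
    then have "\<bar>x - of_rat q\<bar> \<le> d" "\<bar>of_rat q :: real\<bar> \<le> \<bar>x\<bar> + d" by linarith+
    then have "L * \<bar>x - of_rat q\<bar> \<le> L * d" "C * \<bar>of_rat q\<bar> \<le> C * (\<bar>x\<bar> + d)"
      using assms C by (intro mult_left_mono; linarith)+
    moreover have "L * d + C * d \<le> e"
    proof -
      have "L * d + C * d \<le> (C + L + 1) * d" using d by (simp add: algebra_simps)
      also have "\<dots> = e" using assms C by (simp add: d_def)
      finally show ?thesis .
    qed
    ultimately show "- (C * (1 + \<bar>x\<bar>)) \<le> sup_conv b L s x + e"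
      using sup_conv_upper[OF assms, of s q x] growth[of s "of_rat q"] by (simp add: algebra_simps)
  qed
  ultimately show ?thesis by (simp add: abs_le_iff)
qed

lemma borel_measurable_sup_conv:
  assumes [measurable]: "case_prod b \<in> borel_measurable (borel \<Otimes>\<^sub>M borel)" and "C \<le> L"
  shows "case_prod (sup_conv b L) \<in> borel_measurable (borel \<Otimes>\<^sub>M borel)"
  unfolding sup_conv_def case_prod_beta
proof (rule borel_measurable_cSUP)
  show "(\<lambda>x. b (fst x) (of_rat q) - L * \<bar>snd x - of_rat q\<bar>) \<in> borel_measurable (borel \<Otimes>\<^sub>M borel)" for q
    by measurable
qed (use bdd_above_sup_conv[OF assms(2)] in auto)

text \<open>The evaluation point moves with \<open>n\<close>, as needed for drifts along converging
  approximate solutions. From above, continuity handles rationals near \<open>x\<close>, and the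
  growing penalty beats linear growth at the others; from below, one rational close to
  \<open>y n\<close> suffices.\<close>

lemma sup_conv_tendsto:
  fixes L y :: "nat \<Rightarrow> real"
  assumes L: "\<And>n. C \<le> L n" "filterlim L at_top sequentially"
    and cont: "isCont (b s) x" and y: "y \<longlonglongrightarrow> x"
  shows "(\<lambda>n. sup_conv b (L n) s (y n)) \<longlonglongrightarrow> b s x"
proof (rule LIMSEQ_I)
  fix r :: real assume "0 < r"
  define e where "e = r / 3"
  have e: "0 < e" using \<open>0 < r\<close> by (simp add: e_def)
  from cont e obtain d where d: "0 < d" and near: "\<And>z. \<bar>z - x\<bar> < d \<Longrightarrow> \<bar>b s z - b s x\<bar> < e"
    unfolding continuous_at_eps_delta by (auto simp: dist_real_def)
  have "eventually (\<lambda>n. \<bar>y n - x\<bar> < d / 2) sequentially"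
    using tendstoD[OF y, of "d / 2"] d by (simp add: dist_real_def)
  \<comment> \<open>For a rational at distance at least \<open>d\<close> from \<open>x\<close>, put
    \<open>z = \<bar>y n - q\<bar>\<close>. Then \<open>z \<ge> d / 2\<close>, so constants are at
    most \<open>2 / d * z\<close> times themselves, and \<open>b s q - b s x\<close> is at most a
    multiple of \<open>z\<close> below this threshold. The summand 1 also forces
    \<open>L n > 0\<close>.\<close>
  moreover have "eventually (\<lambda>n. 2 * C + (2 * C * (1 + \<bar>x\<bar>) + C * d) * 2 / d + 1 \<le> L n) sequentially"
    using L(2) by (simp add: filterlim_at_top)
  ultimately have "eventually (\<lambda>n. norm (sup_conv b (L n) s (y n) - b s x) < r) sequentially"
  proof eventually_elim
    case (elim n)
    have Ln: "0 \<le> L n" using C L(1)[of n] by linarith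
    have pos: "0 < L n"
      using elim(2) C d by (smt (verit) divide_nonneg_pos mult_nonneg_nonneg abs_ge_zero)
    have "sup_conv b (L n) s (y n) \<le> b s x + e"
      unfolding sup_conv_def
    proof (rule cSUP_least)
      fix q :: rat
      let ?q = "of_rat q :: real"
      show "b s ?q - L n * \<bar>y n - ?q\<bar> \<le> b s x + e"
      proof (cases "\<bar>?q - x\<bar> < d")
        case True
        then have "b s ?q \<le> b s x + e" using near[OF True] by linarith
        then show ?thesis using Ln by (smt (verit) mult_nonneg_nonneg abs_ge_zero)
      next
        case False
        define z where "z = \<bar>y n - ?q\<bar>"
        have z: "d / 2 \<le> z" using False elim(1) unfolding z_def by linarith
        have zx: "\<bar>?q\<bar> \<le> \<bar>x\<bar> + d + z" using elim(1) d unfolding z_def by linarith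
        have "b s ?q - b s x \<le> C * (1 + \<bar>?q\<bar>) + C * (1 + \<bar>x\<bar>)"
          using growth[of s ?q] growth[of s x] by linarith
        also have "\<dots> \<le> C * (1 + (\<bar>x\<bar> + d + z)) + C * (1 + \<bar>x\<bar>)"
          using zx C by (intro add_mono mult_left_mono) auto
        also have "\<dots> = 2 * C * (1 + \<bar>x\<bar>) + C * d + C * z" by (simp add: algebra_simps)
        also have "\<dots> \<le> (2 * C * (1 + \<bar>x\<bar>) + C * d) * (2 / d * z) + C * z"
        proof -
          have "1 \<le> 2 / d * z" using z d by (simp add: field_simps)
          then have "(2 * C * (1 + \<bar>x\<bar>) + C * d) * 1 \<le> (2 * C * (1 + \<bar>x\<bar>) + C * d) * (2 / d * z)"
            using C d by (intro mult_left_mono) auto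
          then show ?thesis by simp
        qed
        also have "\<dots> = (C + (2 * C * (1 + \<bar>x\<bar>) + C * d) * 2 / d) * z"
          by (simp add: distrib_right)
        also have "\<dots> \<le> (2 * C + (2 * C * (1 + \<bar>x\<bar>) + C * d) * 2 / d + 1) * z"
          using z d C by (intro mult_right_mono) auto
        also have "\<dots> \<le> L n * z" using elim(2) z d by (intro mult_right_mono) auto
        finally show ?thesis using e by (simp add: z_def)
      qed
    qed simp
    moreover have "b s x - 2 * e \<le> sup_conv b (L n) s (y n)"
    proof -
      \<comment> \<open>The first bound keeps the rational within \<open>d\<close> of
        \<open>x\<close>, where continuity applies; the second keeps its penalty below
        \<open>e\<close>.\<close>
      define h where "h = min (d / 2) (e / L n)"
      have h: "0 < h" "h \<le> d / 2" "h \<le> e / L n"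
        unfolding h_def using d e pos min.cobounded1[of "d / 2" "e / L n"] min.cobounded2[of "d / 2" "e / L n"]
        by (simp_all only: min_less_iff_conj divide_pos_pos half_gt_zero)
      obtain q where q: "y n - h < of_rat q" "of_rat q < y n"
        using of_rat_dense[of "y n - h" "y n"] h by auto
      have "\<bar>of_rat q - x\<bar> < d" using q elim(1) h(2) by linarith
      from near[OF this] have "b s x - e \<le> b s (of_rat q)" by linarith
      moreover have "L n * \<bar>y n - of_rat q\<bar> \<le> L n * (e / L n)"
        using q h(3) Ln by (intro mult_left_mono) auto
      then have "L n * \<bar>y n - of_rat q\<bar> \<le> e" using pos by simp
      ultimately show ?thesis using sup_conv_upper[OF L(1)[of n], where s = s and q = q and x = "y n"] by linarith
    qed
    ultimately show ?case using e by (simp add: e_def abs_less_iff)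
  qed
  then show "\<exists>N. \<forall>n\<ge>N. norm (sup_conv b (L n) s (y n) - b s x) < r"
    by (simp add: eventually_sequentially)
qed

text \<open>The slope \<open>C + 1 + real n\<close> is at least \<open>C\<close>, is positive even
  when \<open>C = 0\<close>, and tends to infinity. Writing the solution of the n-th equation as a
  \<open>lim\<close> of iterates keeps it measurable in the path.\<close>

definition monotone_scheme :: "(real \<Rightarrow> real) \<Rightarrow> nat \<Rightarrow> real \<Rightarrow> real" where
  "monotone_scheme w n t = lim (\<lambda>k. picard (sup_conv b (C + 1 + real n)) w k t)"

lemma monotone_scheme:
  assumes b: "case_prod b \<in> borel_measurable (borel \<Otimes>\<^sub>M borel)"
    and w: "continuous_on {0..T} w" and T: "0 \<le> T"
  shows monotone_scheme_continuous: "continuous_on {0..T} (monotone_scheme w n)"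
    and monotone_scheme_eq: "t \<in> {0..T} \<Longrightarrow>
      monotone_scheme w n t = w t + (LBINT s:{0..t}. sup_conv b (C + 1 + real n) s (monotone_scheme w n s))"
proof -
  have CL: "C \<le> C + 1 + real n" "0 < C + 1 + real n" using C by auto
  obtain y where y: "continuous_on {0..T} y"
    "\<And>t. t \<in> {0..T} \<Longrightarrow> (\<lambda>k. picard (sup_conv b (C + 1 + real n)) w k t) \<longlonglongrightarrow> y t"
    "\<And>t. t \<in> {0..T} \<Longrightarrow> y t = w t + (LBINT s:{0..t}. sup_conv b (C + 1 + real n) s (y s))"
    using picard_converges[OF borel_measurable_sup_conv[OF b CL(1)] abs_sup_conv_le[OF CL(1)] w
      sup_conv_lipschitz[OF CL(1)] CL(2) T] by blast
  have eq: "monotone_scheme w n t = y t" if "t \<in> {0..T}" for t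
    unfolding monotone_scheme_def using y(2)[OF that] by (rule limI)
  show "continuous_on {0..T} (monotone_scheme w n)"
    using y(1) by (subst continuous_on_cong[OF refl eq])
  show "monotone_scheme w n t = w t + (LBINT s:{0..t}. sup_conv b (C + 1 + real n) s (monotone_scheme w n s))"
    if t: "t \<in> {0..T}"
  proof -
    have "(LBINT s:{0..t}. sup_conv b (C + 1 + real n) s (monotone_scheme w n s))
      = (LBINT s:{0..t}. sup_conv b (C + 1 + real n) s (y s))"
      using eq t by (intro set_lebesgue_integral_cong) auto
    then show ?thesis using y(3)[OF t] eq[OF t] by simp
  qed
qed

text \<open>The limit \<open>X\<close> exists by monotonicity and a uniform bound. A common
  Lipschitz constant of the approximations minus \<open>w\<close> passes to \<open>X - w\<close>;
  this makes \<open>X\<close> continuous and its level sets null before any equation for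
  \<open>X\<close> is known, so the drifts converge at almost every time.\<close>

lemma monotone_scheme_limit:
  assumes b: "case_prod b \<in> borel_measurable (borel \<Otimes>\<^sub>M borel)"
    and w: "continuous_on {0..T} w" and T: "0 \<le> T" and S: "countable S"
    and cont: "\<And>s x. x \<notin> S \<Longrightarrow> isCont (b s) x"
    and null: "null_lipschitz_sets T w"
  defines "X \<equiv> \<lambda>t. lim (\<lambda>n. monotone_scheme w n t)"
  shows "set_integrable lborel {0..T} (\<lambda>s. b s (X s))"
    and "\<And>t. t \<in> {0..T} \<Longrightarrow> X t = w t + (LBINT s:{0..t}. b s (X s))"
proof -
  let ?L = "\<lambda>n. C + 1 + real n"
  let ?b = "\<lambda>n. sup_conv b (?L n)"
  let ?Y = "monotone_scheme w"
  have CL: "C \<le> ?L n" "0 < ?L n" for n using C by auto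
  note contY = monotone_scheme_continuous[OF b w T]
  note eqY = monotone_scheme_eq[OF b w T]
  note measb = borel_measurable_sup_conv[OF b CL(1)]
  have int: "set_integrable lborel {0..T} (\<lambda>s. ?b n s (?Y n s))" for n
    by (rule set_integrable_along_path[OF measb abs_sup_conv_le[OF CL(1)] contY])
  have "bounded (w ` {0..T})"
    by (intro compact_imp_bounded compact_continuous_image w) simp
  then obtain A where A: "\<And>t. t \<in> {0..T} \<Longrightarrow> \<bar>w t\<bar> \<le> A"
    unfolding bounded_iff by force
  have A0: "0 \<le> A" using A[of 0] T by auto
  \<comment> \<open>The Gronwall bound for \<open>\<bar>?Y n t\<bar>\<close> with rate
    \<open>C + 1\<close>, which is positive also for \<open>C = 0\<close>; the constant part of the
    growth bound contributes \<open>(C + 1) * T\<close>. Nothing here depends on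
    \<open>n\<close>.\<close>
  define R where "R = 2 * (A + (C + 1) * T) * exp (2 * (C + 1) * T)"
  have R: "\<bar>?Y n t\<bar> \<le> R" if t: "t \<in> {0..T}" for n t
    unfolding R_def
  proof (rule gronwall[OF _ _ _ _ t])
    show "continuous_on {0..T} (\<lambda>t. \<bar>?Y n t\<bar>)" by (intro continuous_intros contY)
    fix t assume t: "t \<in> {0..T}"
    have iY: "set_integrable lborel {0..t} (\<lambda>s. \<bar>?Y n s\<bar>)"
      using t by (intro borel_integrable_atLeastAtMost' continuous_intros continuous_on_subset[OF contY]) auto
    have i1: "set_integrable lborel {0..t} (\<lambda>s. (C + 1) :: real)"
      by (intro borel_integrable_atLeastAtMost' continuous_intros)
    have "\<bar>LBINT s:{0..t}. ?b n s (?Y n s)\<bar> \<le> (LBINT s:{0..t}. \<bar>?b n s (?Y n s)\<bar>)"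
      by (rule set_integral_norm_bound[OF set_integrable_initial[OF int t], unfolded real_norm_def])
    also have "\<dots> \<le> (LBINT s:{0..t}. (C + 1) + (C + 1) * \<bar>?Y n s\<bar>)"
    proof (rule set_integral_mono)
      show "set_integrable lborel {0..t} (\<lambda>s. \<bar>?b n s (?Y n s)\<bar>)"
        by (rule set_integrable_abs[OF set_integrable_initial[OF int t]])
      show "set_integrable lborel {0..t} (\<lambda>s. (C + 1) + (C + 1) * \<bar>?Y n s\<bar>)"
        by (rule set_integral_add(1)[OF i1 set_integrable_mult_right[OF iY]])
      show "\<bar>?b n s (?Y n s)\<bar> \<le> (C + 1) + (C + 1) * \<bar>?Y n s\<bar>" for s
        using abs_sup_conv_le[OF CL(1), of n s "?Y n s"] by (simp add: algebra_simps)
    qed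
    also have "\<dots> = (LBINT s:{0..t}. (C + 1)) + (C + 1) * (LBINT s:{0..t}. \<bar>?Y n s\<bar>)"
      unfolding set_integral_add(2)[OF i1 set_integrable_mult_right[OF iY]] by simp
    also have "(LBINT s:{0..t}. (C + 1)) = (C + 1) * t"
      using t by (simp add: set_lebesgue_integral_def)
    also have "\<dots> \<le> (C + 1) * T" using t C by (intro mult_left_mono) auto
    finally show "\<bar>?Y n t\<bar> \<le> A + (C + 1) * T + (C + 1) * (LBINT s:{0..t}. \<bar>?Y n s\<bar>)"
      using A[OF t] eqY[OF t, of n] by linarith
  qed (use C A0 T in auto)
  have dec: "?Y (Suc n) t \<le> ?Y n t" if t: "t \<in> {0..T}" for n t
  proof -
    \<comment> \<open>The drift of index \<open>Suc n\<close> is first replaced by the larger one of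
      index \<open>n\<close> at the same point; the Lipschitz bound of the latter then gives the
      one-sided estimate, with a rate that may depend on \<open>n\<close>.\<close>
    have "?Y (Suc n) t - ?Y n t \<le> 0"
    proof (rule comparison[OF set_integral_diff(1)[OF int[of "Suc n"] int[of n]] CL(2)[of n] _ _ t])
      fix t assume t: "t \<in> {0..T}"
      show "?Y (Suc n) t - ?Y n t = (LBINT s:{0..t}. ?b (Suc n) s (?Y (Suc n) s) - ?b n s (?Y n s))"
        unfolding set_integral_diff(2)[OF set_integrable_initial[OF int[of "Suc n"] t] set_integrable_initial[OF int[of n] t]]
        using eqY[OF t, of n] eqY[OF t, of "Suc n"] by linarith
    next
      fix s assume pos: "0 < ?Y (Suc n) s - ?Y n s"
      have "?b (Suc n) s (?Y (Suc n) s) \<le> ?b n s (?Y (Suc n) s)"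
        by (rule sup_conv_antimono) auto
      then show "?b (Suc n) s (?Y (Suc n) s) - ?b n s (?Y n s) \<le> ?L n * (?Y (Suc n) s - ?Y n s)"
        using sup_conv_lipschitz[OF CL(1), of n s "?Y (Suc n) s" "?Y n s"] pos by simp
    qed
    then show ?thesis by simp
  qed
  have lim: "(\<lambda>n. ?Y n t) \<longlonglongrightarrow> X t" if t: "t \<in> {0..T}" for t
  proof -
    have "decseq (\<lambda>n. ?Y n t)" using dec[OF t] by (simp add: decseq_Suc_iff)
    moreover have "- R \<le> ?Y n t" for n using R[OF t, of n] by linarith
    ultimately obtain l where "(\<lambda>n. ?Y n t) \<longlonglongrightarrow> l" using decseq_convergent by blast
    then show ?thesis unfolding X_def by (simp add: limI)
  qed
  define K where "K = C * (1 + R)"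
  have bK: "\<bar>?b n s (?Y n s)\<bar> \<le> K" if "s \<in> {0..T}" for n s
  proof -
    have "C * (1 + \<bar>?Y n s\<bar>) \<le> K" unfolding K_def using R[OF that] C by (intro mult_left_mono) auto
    then show ?thesis using abs_sup_conv_le[OF CL(1), of n s "?Y n s"] by linarith
  qed
  have lipX: "\<bar>(X t - w t) - (X s - w s)\<bar> \<le> K * \<bar>t - s\<bar>" if s: "s \<in> {0..T}" and t: "t \<in> {0..T}" for s t
  proof (rule LIMSEQ_le_const2)
    show "(\<lambda>n. \<bar>(?Y n t - w t) - (?Y n s - w s)\<bar>) \<longlonglongrightarrow> \<bar>(X t - w t) - (X s - w s)\<bar>"
      by (intro tendsto_intros lim s t)
    have "\<bar>(?Y n t - w t) - (?Y n s - w s)\<bar> \<le> K * \<bar>t - s\<bar>" for n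
      using LBINT_diff_le[OF int _ _ _ bK, of s t] LBINT_diff_le[OF int _ _ _ bK, of t s] s t
        eqY[OF s, of n] eqY[OF t, of n]
      by (cases "s \<le> t") (auto simp: abs_minus_commute)
    then show "\<exists>N. \<forall>n\<ge>N. \<bar>(?Y n t - w t) - (?Y n s - w s)\<bar> \<le> K * \<bar>t - s\<bar>" by blast
  qed
  have "K-lipschitz_on {0..T} (\<lambda>t. X t - w t)"
  proof (rule lipschitz_onI)
    show "0 \<le> K" using bK[of 0] T by force
  qed (use lipX in \<open>auto simp: dist_real_def\<close>)
  then have "continuous_on {0..T} (\<lambda>t. (X t - w t) + w t)"
    by (intro continuous_on_add w lipschitz_on_continuous_on)
  then have contX: "continuous_on {0..T} X" by simp
  show intX: "set_integrable lborel {0..T} (\<lambda>s. b s (X s))"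
    by (rule set_integrable_along_path[OF b growth contX])
  have "(\<Union>a\<in>S. {t \<in> {0..T}. X t = a}) \<in> null_sets lborel"
    using S level_set_null[OF null contX, of K] lipX by (intro null_sets_UN') auto
  then have off: "AE s in lborel. s \<in> {0..T} \<longrightarrow> X s \<notin> S"
    by (rule AE_I') auto
  have Linf: "filterlim ?L at_top sequentially"
    by (intro filterlim_tendsto_add_at_top[OF tendsto_const] filterlim_real_sequentially)
  \<comment> \<open>Off the null set of times spent in \<open>S\<close>, the drift is continuous at
    \<open>X s\<close> and the approximate drifts converge there; \<open>K\<close> dominates
    them.\<close>
  fix t assume t: "t \<in> {0..T}"
  have "(\<lambda>n. LBINT s:{0..t}. ?b n s (?Y n s)) \<longlonglongrightarrow> (LBINT s:{0..t}. b s (X s))"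
    unfolding set_lebesgue_integral_def
  proof (rule integral_dominated_convergence)
    show "(\<lambda>s. indicator {0..t} s *\<^sub>R b s (X s)) \<in> borel_measurable lborel"
      using set_integrable_initial[OF intX t] by (simp add: set_integrable_def)
    show "(\<lambda>s. indicator {0..t} s *\<^sub>R ?b n s (?Y n s)) \<in> borel_measurable lborel" for n
      using set_integrable_initial[OF int t, of n] by (simp add: set_integrable_def)
    show "integrable lborel (\<lambda>s. indicator {0..t} s *\<^sub>R K)"
      using borel_integrable_atLeastAtMost'[of 0 t "\<lambda>_. K"] by (simp add: set_integrable_def)
    show "AE s in lborel. norm (indicator {0..t} s *\<^sub>R ?b n s (?Y n s)) \<le> indicator {0..t} s *\<^sub>R K" for n
      using bK[of _ n] t by (auto simp: indicator_def)
    show "AE s in lborel. (\<lambda>n. indicator {0..t} s *\<^sub>R ?b n s (?Y n s)) \<longlonglongrightarrow> indicator {0..t} s *\<^sub>R b s (X s)"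
      using off
    proof eventually_elim
      case (elim s)
      show ?case
      proof (cases "s \<in> {0..t}")
        case True
        then have s: "s \<in> {0..T}" using t by auto
        with elim have "(\<lambda>n. ?b n s (?Y n s)) \<longlonglongrightarrow> b s (X s)"
          using sup_conv_tendsto[OF CL(1) Linf cont lim[OF s]] by blast
        then show ?thesis by (intro tendsto_scaleR tendsto_const)
      qed simp
    qed
  qed
  then have "(\<lambda>n. w t + (LBINT s:{0..t}. ?b n s (?Y n s))) \<longlonglongrightarrow> w t + (LBINT s:{0..t}. b s (X s))"
    by (rule tendsto_add[OF tendsto_const])
  then have "(\<lambda>n. ?Y n t) \<longlonglongrightarrow> w t + (LBINT s:{0..t}. b s (X s))"
    using eqY[OF t] by simp
  then show "X t = w t + (LBINT s:{0..t}. b s (X s))"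
    by (rule LIMSEQ_unique[OF lim[OF t]])
qed

end

section \<open>Adapted processes\<close>

text \<open>Clamping the time to \<open>[0, t]\<close> makes the process a function of a time in all of \<open>lborel\<close>.\<close>

lemma borel_measurable_continuous_process:
  fixes X :: "real \<Rightarrow> 'a \<Rightarrow> real"
  assumes X: "\<And>s. s \<in> {0..t} \<Longrightarrow> X s \<in> borel_measurable F" and t: "0 \<le> t"
    and cont: "\<And>\<omega>. \<omega> \<in> space F \<Longrightarrow> continuous_on {0..t} (\<lambda>s. X s \<omega>)"
  shows "(\<lambda>(\<omega>, s). X (max 0 (min t s)) \<omega>) \<in> borel_measurable (F \<Otimes>\<^sub>M lborel)"
proof (rule borel_measurable_LIMSEQ_real)
  let ?c = "\<lambda>s. max 0 (min t s)"
  \<comment> \<open>Time is rounded down to a grid of mesh 1 / (k + 1). For fixed \<open>k\<close>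
    only countably many variables of the process occur, which gives joint measurability; continuity
    of the paths handles the limit.\<close>
  let ?g = "\<lambda>k s. of_int \<lfloor>s * real (Suc k)\<rfloor> / real (Suc k)"
  show "(\<lambda>(\<omega>, s). X (?c (?g k s)) \<omega>) \<in> borel_measurable (F \<Otimes>\<^sub>M lborel)" for k
  proof -
    have [measurable]: "(\<lambda>z. X (?c (of_int i / real (Suc k))) (fst z)) \<in> borel_measurable (F \<Otimes>\<^sub>M lborel)" for i
      using t by (intro measurable_compose[OF measurable_fst] X) auto
    have "(\<lambda>z. X (?c (of_int \<lfloor>snd z * real (Suc k)\<rfloor> / real (Suc k))) (fst z)) \<in> borel_measurable (F \<Otimes>\<^sub>M lborel)"
      by (rule measurable_compose_countable[where f = "\<lambda>i z. X (?c (of_int i / real (Suc k))) (fst z)"]) measurable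
    then show ?thesis by (simp add: case_prod_beta)
  qed
  fix z assume z: "z \<in> space (F \<Otimes>\<^sub>M (lborel :: real measure))"
  obtain \<omega> s where zs: "z = (\<omega>, s)" by (cases z)
  have \<omega>: "\<omega> \<in> space F" using z zs by (simp add: space_pair_measure)
  have "(\<lambda>k. ?g k s) \<longlonglongrightarrow> s"
  proof (rule tendsto_sandwich)
    show "(\<lambda>k. s - 1 / real (Suc k)) \<longlonglongrightarrow> s"
      using tendsto_diff[OF tendsto_const LIMSEQ_inverse_real_of_nat, of s] by (simp add: divide_inverse)
    show "eventually (\<lambda>k. s - 1 / real (Suc k) \<le> ?g k s) sequentially"
    proof (rule always_eventually, rule allI)
      fix k
      have "s - 1 / real (Suc k) = (s * real (Suc k) - 1) / real (Suc k)" by (simp add: field_simps)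
      also have "\<dots> \<le> ?g k s" by (intro divide_right_mono) linarith+
      finally show "s - 1 / real (Suc k) \<le> ?g k s" .
    qed
    show "eventually (\<lambda>k. ?g k s \<le> s) sequentially"
      by (rule always_eventually) (simp add: divide_le_eq)
  qed (rule tendsto_const)
  then have "(\<lambda>k. ?c (?g k s)) \<longlonglongrightarrow> ?c s" by (intro tendsto_intros)
  then have "(\<lambda>k. X (?c (?g k s)) \<omega>) \<longlonglongrightarrow> X (?c s) \<omega>"
    using t by (intro continuous_on_tendsto_compose[OF cont[OF \<omega>]]) auto
  then show "(\<lambda>k. case z of (\<omega>, s) \<Rightarrow> X (?c (?g k s)) \<omega>) \<longlonglongrightarrow> (case z of (\<omega>, s) \<Rightarrow> X (?c s) \<omega>)"
    by (simp add: zs)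
qed

text \<open>Measurability of an integral depending on a parameter. Only the process on
  \<open>{0..t}\<close> enters, so with \<open>F\<close> the information at time \<open>t\<close>
  this is the adaptedness of one Picard step.\<close>

lemma borel_measurable_LBINT_process:
  fixes X :: "real \<Rightarrow> 'a \<Rightarrow> real"
  assumes X: "\<And>s. s \<in> {0..t} \<Longrightarrow> X s \<in> borel_measurable F" and t: "0 \<le> t"
    and cont: "\<And>\<omega>. \<omega> \<in> space F \<Longrightarrow> continuous_on {0..t} (\<lambda>s. X s \<omega>)"
    and b[measurable]: "case_prod b \<in> borel_measurable (borel \<Otimes>\<^sub>M borel)"
  shows "(\<lambda>\<omega>. LBINT s:{0..t}. b s (X s \<omega>) :: real) \<in> borel_measurable F"
proof -
  have [measurable]: "(\<lambda>z. X (max 0 (min t (snd z))) (fst z)) \<in> borel_measurable (F \<Otimes>\<^sub>M lborel)"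
    using borel_measurable_continuous_process[OF X t cont] by (simp add: case_prod_beta)
  have "(\<lambda>\<omega>. LBINT s. indicator {0..t} s *\<^sub>R b s (X (max 0 (min t s)) \<omega>)) \<in> borel_measurable F"
    by (rule lborel.borel_measurable_lebesgue_integral) (simp add: case_prod_beta, measurable)
  also have "(\<lambda>\<omega>. LBINT s. indicator {0..t} s *\<^sub>R b s (X (max 0 (min t s)) \<omega>))
    = (\<lambda>\<omega>. LBINT s:{0..t}. b s (X s \<omega>))"
    unfolding set_lebesgue_integral_def
    by (intro ext Bochner_Integration.integral_cong) (auto simp: indicator_def)
  finally show ?thesis .
qed

section \<open>Measurability with respect to the augmented filtration\<close>

lemma space_augmented_filtration [simp]: "space (augmented_filtration M W t) = space M"
  by (simp add: augmented_filtration_def space_measure_of_conv)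

lemma sets_augmented_filtration:
  "sets (augmented_filtration M W t) =
     sigma_sets (space M) ((\<Union>s\<in>{0..t}. sets (vimage_algebra (space M) (W s) borel)) \<union> null_sets M)"
  unfolding augmented_filtration_def
proof (rule sets_measure_of)
  have "A \<subseteq> space M" if "A \<in> sets (vimage_algebra (space M) (W s) borel)" for A s
    using sets.sets_into_space[OF that] by simp
  then show "(\<Union>s\<in>{0..t}. sets (vimage_algebra (space M) (W s) borel)) \<union> null_sets M \<subseteq> Pow (space M)"
    using sets.sets_into_space[of _ M] by (force simp: null_sets_def)
qed

lemma null_sets_augmented_filtration: "N \<in> null_sets M \<Longrightarrow> N \<in> sets (augmented_filtration M W t)"
  unfolding sets_augmented_filtration by auto

lemma borel_measurable_augmented_filtration:
  assumes "s \<in> {0..t}"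
  shows "W s \<in> borel_measurable (augmented_filtration M W t)"
proof (rule measurableI)
  fix A :: "real set" assume "A \<in> sets borel"
  then have "W s -` A \<inter> space M \<in> sets (vimage_algebra (space M) (W s) borel)"
    by (rule in_vimage_algebra)
  then show "W s -` A \<inter> space (augmented_filtration M W t) \<in> sets (augmented_filtration M W t)"
    using assms unfolding sets_augmented_filtration by (auto intro!: sigma_sets.Basic)
qed simp

lemma augmented_filtration_mono:
  assumes "f \<in> borel_measurable (augmented_filtration M W s)" "s \<le> t"
  shows "f \<in> borel_measurable (augmented_filtration M W t)"
proof -
  have "sets (augmented_filtration M W s) \<subseteq> sets (augmented_filtration M W t)"
    unfolding sets_augmented_filtration using assms(2)
    by (intro sigma_sets_mono') (auto 4 4)
  then show ?thesis using assms(1) by (auto simp: measurable_def)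
qed

text \<open>By completeness every subset of a null set is again a null set of \<open>M\<close>, and
  all of these belong to the filtration at each time.\<close>

lemma borel_measurable_augmented_filtration_AE:
  fixes f g :: "'a \<Rightarrow> real"
  assumes M: "complete_measure M"
    and f: "f \<in> borel_measurable (augmented_filtration M W t)"
    and eq: "AE \<omega> in M. f \<omega> = g \<omega>"
  shows "g \<in> borel_measurable (augmented_filtration M W t)"
proof (rule measurableI)
  obtain N where N: "\<And>\<omega>. \<omega> \<in> space M - N \<Longrightarrow> f \<omega> = g \<omega>" "N \<in> null_sets M"
    by (rule AE_E3[OF eq], rule that) simp_all
  fix A assume A: "A \<in> sets (borel :: real measure)"
  let ?F = "sets (augmented_filtration M W t)"
  have "g -` A \<inter> space M \<inter> N \<in> null_sets M"
    by (rule complete_measure.complete2[OF M _ N(2)]) auto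
  then have "g -` A \<inter> space M \<inter> N \<in> ?F" "N \<in> ?F" "f -` A \<inter> space M \<in> ?F"
    using measurable_sets[OF f A] null_sets_augmented_filtration[OF N(2)] null_sets_augmented_filtration
    by simp_all
  then have "(f -` A \<inter> space M - N) \<union> (g -` A \<inter> space M \<inter> N) \<in> ?F"
    by (intro sets.Un sets.Diff)
  also have "(f -` A \<inter> space M - N) \<union> (g -` A \<inter> space M \<inter> N) = g -` A \<inter> space M"
    using N(1) by auto
  finally show "g -` A \<inter> space (augmented_filtration M W t) \<in> ?F"
    by simp
qed simp

lemma picard_adapted:
  fixes w :: "real \<Rightarrow> 'a \<Rightarrow> real"
  assumes b: "case_prod b \<in> borel_measurable (borel \<Otimes>\<^sub>M borel)"
    and growth: "\<And>s x. \<bar>b s x\<bar> \<le> C * (1 + \<bar>x\<bar>)"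
    and w: "\<And>t. t \<in> {0..T} \<Longrightarrow> w t \<in> borel_measurable (augmented_filtration M W t)"
    and cont: "\<And>\<omega>. continuous_on {0..T} (\<lambda>t. w t \<omega>)"
    and t: "t \<in> {0..T}"
  shows "(\<lambda>\<omega>. picard b (\<lambda>t. w t \<omega>) k t) \<in> borel_measurable (augmented_filtration M W t)"
  using t
proof (induction k arbitrary: t)
  case (Suc k)
  have "(\<lambda>\<omega>. LBINT s:{0..t}. b s (picard b (\<lambda>t. w t \<omega>) k s)) \<in> borel_measurable (augmented_filtration M W t)"
  proof (rule borel_measurable_LBINT_process[OF _ _ _ b])
    show "(\<lambda>\<omega>. picard b (\<lambda>t. w t \<omega>) k s) \<in> borel_measurable (augmented_filtration M W t)" if "s \<in> {0..t}" for s
      using that Suc.prems by (intro augmented_filtration_mono[OF Suc.IH]) auto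
    show "continuous_on {0..t} (picard b (\<lambda>t. w t \<omega>) k)" for \<omega>
      using Suc.prems by (intro continuous_on_subset[OF continuous_on_picard[OF b growth cont]]) auto
  qed (use Suc.prems in auto)
  then show ?case
    using w[OF Suc.prems] by (simp add: picard.simps(2))
qed (use w in simp)

section \<open>Wiener integrals\<close>

lemma integrable_mult_of_squares:
  fixes f g :: "'a \<Rightarrow> real"
  assumes [measurable]: "f \<in> borel_measurable M" "g \<in> borel_measurable M"
    and "integrable M (\<lambda>x. (f x)\<^sup>2)" "integrable M (\<lambda>x. (g x)\<^sup>2)"
  shows "integrable M (\<lambda>x. f x * g x)"
proof (rule Bochner_Integration.integrable_bound)
  show "integrable M (\<lambda>x. (f x)\<^sup>2 + (g x)\<^sup>2)" using assms by simp
  have "\<bar>a * b\<bar> \<le> a\<^sup>2 + b\<^sup>2" for a b :: real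
    using sum_squares_bound[of "\<bar>a\<bar>" "\<bar>b\<bar>"] abs_ge_zero[of "a * b"]
    unfolding abs_mult power2_abs by linarith
  then show "AE x in M. norm (f x * g x) \<le> norm ((f x)\<^sup>2 + (g x)\<^sup>2)" by simp
qed measurable

lemma integrable_square_diff:
  fixes f g :: "'a \<Rightarrow> real"
  assumes [measurable]: "f \<in> borel_measurable M" "g \<in> borel_measurable M"
    and "integrable M (\<lambda>x. (f x)\<^sup>2)" "integrable M (\<lambda>x. (g x)\<^sup>2)"
  shows "integrable M (\<lambda>x. (f x - g x)\<^sup>2)"
  using assms integrable_mult_of_squares[OF assms] by (simp add: power2_diff mult.assoc)

lemma integral_square_diff_le:
  fixes f g :: "'a \<Rightarrow> real"
  assumes [measurable]: "f \<in> borel_measurable M" "g \<in> borel_measurable M"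
    and sq: "integrable M (\<lambda>x. (f x)\<^sup>2)" "integrable M (\<lambda>x. (g x)\<^sup>2)"
  shows "(\<integral>x. (f x - g x)\<^sup>2 \<partial>M) \<le> 2 * (\<integral>x. (f x)\<^sup>2 \<partial>M) + 2 * (\<integral>x. (g x)\<^sup>2 \<partial>M)"
proof -
  have "(a - b)\<^sup>2 \<le> 2 * a\<^sup>2 + 2 * b\<^sup>2" for a b :: real
    using zero_le_power2[of "a + b"] by (simp add: power2_eq_square algebra_simps)
  then have "(\<integral>x. (f x - g x)\<^sup>2 \<partial>M) \<le> (\<integral>x. 2 * (f x)\<^sup>2 + 2 * (g x)\<^sup>2 \<partial>M)"
    using sq by (intro integral_mono integrable_square_diff) auto
  also have "\<dots> = 2 * (\<integral>x. (f x)\<^sup>2 \<partial>M) + 2 * (\<integral>x. (g x)\<^sup>2 \<partial>M)" using sq by simp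
  finally show ?thesis .
qed

text \<open>Used for indicators of disjoint intervals and for independent centred Brownian
  increments. Both families have the interval lengths as squared norms, and equality of the two
  results is the Wiener isometry.\<close>

lemma integral_square_sum_orthogonal:
  fixes \<phi> :: "nat \<Rightarrow> 'a \<Rightarrow> real"
  assumes int: "\<And>i j. i < n \<Longrightarrow> j < n \<Longrightarrow> integrable M (\<lambda>x. \<phi> i x * \<phi> j x)"
    and orth: "\<And>i j. i < n \<Longrightarrow> j < n \<Longrightarrow> i \<noteq> j \<Longrightarrow> (\<integral>x. \<phi> i x * \<phi> j x \<partial>M) = 0"
    and norm: "\<And>i. i < n \<Longrightarrow> (\<integral>x. \<phi> i x * \<phi> i x \<partial>M) = v i"
  shows "integrable M (\<lambda>x. (\<Sum>i<n. d i * \<phi> i x)\<^sup>2)"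
    and "(\<integral>x. (\<Sum>i<n. d i * \<phi> i x)\<^sup>2 \<partial>M) = (\<Sum>i<n. (d i)\<^sup>2 * v i)"
proof -
  have eq: "(\<lambda>x. (\<Sum>i<n. d i * \<phi> i x)\<^sup>2) = (\<lambda>x. \<Sum>i<n. \<Sum>j<n. d i * d j * (\<phi> i x * \<phi> j x))"
    by (simp add: power2_eq_square sum_product ac_simps)
  have int': "integrable M (\<lambda>x. d i * d j * (\<phi> i x * \<phi> j x))" if "i \<in> {..<n}" "j \<in> {..<n}" for i j
    using int[of i j] that by (intro integrable_mult_right) auto
  show "integrable M (\<lambda>x. (\<Sum>i<n. d i * \<phi> i x)\<^sup>2)"
    unfolding eq by (intro Bochner_Integration.integrable_sum int')
  have "(\<integral>x. (\<Sum>i<n. d i * \<phi> i x)\<^sup>2 \<partial>M) = (\<Sum>i<n. \<Sum>j<n. d i * d j * (\<integral>x. \<phi> i x * \<phi> j x \<partial>M))"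
    unfolding eq
  proof (subst Bochner_Integration.integral_sum)
    show "(\<Sum>i<n. \<integral>x. (\<Sum>j<n. d i * d j * (\<phi> i x * \<phi> j x)) \<partial>M)
      = (\<Sum>i<n. \<Sum>j<n. d i * d j * (\<integral>x. \<phi> i x * \<phi> j x \<partial>M))"
      by (intro sum.cong refl, subst Bochner_Integration.integral_sum, rule int', assumption+, simp)
  qed (intro Bochner_Integration.integrable_sum int')
  also have "\<dots> = (\<Sum>i<n. \<Sum>j<n. if j = i then (d i)\<^sup>2 * v i else 0)"
    using orth norm by (intro sum.cong refl) (auto simp: power2_eq_square)
  finally show "(\<integral>x. (\<Sum>i<n. d i * \<phi> i x)\<^sup>2 \<partial>M) = (\<Sum>i<n. (d i)\<^sup>2 * v i)"
    by simp
qed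

text \<open>The condition on the grids in \<open>has_wiener_integral\<close>. Repeated points are
  allowed, so cutting a partition at a time \<open>t\<close> by \<open>min\<close> or
  \<open>max\<close> leaves a partition with the same number of points.\<close>

definition partition_of :: "real \<Rightarrow> nat \<Rightarrow> (nat \<Rightarrow> real) \<Rightarrow> bool" where
  "partition_of T n p \<longleftrightarrow> 0 \<le> p 0 \<and> p n \<le> T \<and> (\<forall>i<n. p i \<le> p (Suc i))"

lemma partition_of_mono:
  assumes "partition_of T n p" "i \<le> j" "j \<le> n"
  shows "p i \<le> p j"
  using assms(2,3)
proof (induction rule: dec_induct)
  case (step m)
  then have "p m \<le> p (Suc m)" "p i \<le> p m" using assms(1) by (simp_all add: partition_of_def)
  then show ?case by simp
qed simp

lemma partition_of_bounds:
  assumes "partition_of T n p" "i \<le> n"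
  shows "0 \<le> p i" "p i \<le> T"
  using partition_of_mono[OF assms(1), of 0 i] partition_of_mono[OF assms(1), of i n] assms
  by (auto simp: partition_of_def)

lemma integral_square_step_function:
  assumes p: "partition_of T n p"
  defines "\<phi> \<equiv> \<lambda>i s. indicator {p i<..p (Suc i)} s :: real"
  shows "integrable lborel (\<lambda>s. (\<Sum>i<n. d i * \<phi> i s)\<^sup>2)"
    and "(\<integral>s. (\<Sum>i<n. d i * \<phi> i s)\<^sup>2 \<partial>lborel) = (\<Sum>i<n. (d i)\<^sup>2 * (p (Suc i) - p i))"
proof -
  have prod: "\<phi> i s * \<phi> j s = indicator ({p i<..p (Suc i)} \<inter> {p j<..p (Suc j)}) s" for i j s
    by (simp only: \<phi>_def indicator_inter_arith)
  have disj: "{p i<..p (Suc i)} \<inter> {p j<..p (Suc j)} = {}" if "i < n" "j < n" "i \<noteq> j" for i j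
    using partition_of_mono[OF p, of "Suc i" j] partition_of_mono[OF p, of "Suc j" i] that
    by (cases "i < j") auto
  have int: "integrable lborel (\<lambda>s. \<phi> i s * \<phi> j s)" if "i < n" "j < n" for i j
    unfolding prod
  proof (rule integrable_real_indicator)
    show "emeasure lborel ({p i<..p (Suc i)} \<inter> {p j<..p (Suc j)}) < \<infinity>"
      by (rule emeasure_bounded_finite, rule bounded_subset[OF bounded_closed_interval[of "p i" "p (Suc i)"]]) auto
  qed simp
  have orth: "(\<integral>s. \<phi> i s * \<phi> j s \<partial>lborel) = 0" if "i < n" "j < n" "i \<noteq> j" for i j
    unfolding prod disj[OF that] by simp
  have norm: "(\<integral>s. \<phi> i s * \<phi> i s \<partial>lborel) = p (Suc i) - p i" if "i < n" for i
    unfolding prod Int_absorb using partition_of_mono[OF p, of i "Suc i"] that by simp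
  show "integrable lborel (\<lambda>s. (\<Sum>i<n. d i * \<phi> i s)\<^sup>2)"
    and "(\<integral>s. (\<Sum>i<n. d i * \<phi> i s)\<^sup>2 \<partial>lborel) = (\<Sum>i<n. (d i)\<^sup>2 * (p (Suc i) - p i))"
    by (rule integral_square_sum_orthogonal[OF int orth norm]; assumption)+
qed

lemma brownian_motion_increment:
  assumes M: "prob_space M" and W: "brownian_motion M T W" and st: "0 \<le> s" "s \<le> t" "t \<le> T"
  shows "integrable M (\<lambda>\<omega>. W t \<omega> - W s \<omega>)" "(\<integral>\<omega>. W t \<omega> - W s \<omega> \<partial>M) = 0"
    and "integrable M (\<lambda>\<omega>. (W t \<omega> - W s \<omega>)\<^sup>2)" "(\<integral>\<omega>. (W t \<omega> - W s \<omega>)\<^sup>2 \<partial>M) = t - s"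
proof -
  interpret prob_space M by (rule M)
  have "integrable M (\<lambda>\<omega>. W t \<omega> - W s \<omega>) \<and> (\<integral>\<omega>. W t \<omega> - W s \<omega> \<partial>M) = 0 \<and>
    integrable M (\<lambda>\<omega>. (W t \<omega> - W s \<omega>)\<^sup>2) \<and> (\<integral>\<omega>. (W t \<omega> - W s \<omega>)\<^sup>2 \<partial>M) = t - s"
  proof (cases "s = t")
    case False
    then have st': "s < t" using st by simp
    have D: "distributed M lborel (\<lambda>\<omega>. W t \<omega> - W s \<omega>) (normal_density 0 (sqrt (t - s)))"
      using W st' st unfolding brownian_motion_def by blast
    have pos: "0 < sqrt (t - s)" using st' by simp
    have "integrable M (\<lambda>\<omega>. (W t \<omega> - W s \<omega>) ^ k)" for k
      using distributed_integrable[OF D, of "\<lambda>x. x ^ k"] integrable_normal_moment[OF pos, of 0 k] by simp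
    from this[of 1] this[of 2] show ?thesis
      using normal_distributed_expectation[OF pos D] normal_distributed_variance[OF pos D] st' by simp
  qed simp
  then show "integrable M (\<lambda>\<omega>. W t \<omega> - W s \<omega>)" "(\<integral>\<omega>. W t \<omega> - W s \<omega> \<partial>M) = 0"
    and "integrable M (\<lambda>\<omega>. (W t \<omega> - W s \<omega>)\<^sup>2)" "(\<integral>\<omega>. (W t \<omega> - W s \<omega>)\<^sup>2 \<partial>M) = t - s"
    by auto
qed

lemma wiener_isometry:
  assumes M: "prob_space M" and W: "brownian_motion M T W" and p: "partition_of T n p"
  defines "\<phi> \<equiv> \<lambda>i \<omega>. W (p (Suc i)) \<omega> - W (p i) \<omega>"
  shows "integrable M (\<lambda>\<omega>. (\<Sum>i<n. d i * \<phi> i \<omega>)\<^sup>2)"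
    and "(\<integral>\<omega>. (\<Sum>i<n. d i * \<phi> i \<omega>)\<^sup>2 \<partial>M) = (\<Sum>i<n. (d i)\<^sup>2 * (p (Suc i) - p i))"
proof -
  interpret prob_space M by (rule M)
  have pi: "0 \<le> p i" "p i \<le> p (Suc i)" "p (Suc i) \<le> T" if "i < n" for i
    using partition_of_bounds[OF p, of i] partition_of_bounds[OF p, of "Suc i"] partition_of_mono[OF p, of i "Suc i"] that by auto
  have inc: "integrable M (\<phi> i)" "(\<integral>\<omega>. \<phi> i \<omega> \<partial>M) = 0"
    "integrable M (\<lambda>\<omega>. (\<phi> i \<omega>)\<^sup>2)" "(\<integral>\<omega>. (\<phi> i \<omega>)\<^sup>2 \<partial>M) = p (Suc i) - p i" if "i < n" for i
    unfolding \<phi>_def using brownian_motion_increment[OF M W pi[OF that]] by blast+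
  have "indep_vars (\<lambda>_. borel) (\<lambda>i \<omega>. W (p (Suc i)) \<omega> - W (p i) \<omega>) {..<n}"
    using W p unfolding brownian_motion_def partition_of_def by blast
  then have indep: "indep_vars (\<lambda>_. borel) \<phi> {..<n}" by (simp add: \<phi>_def)
  have int: "integrable M (\<lambda>\<omega>. \<phi> i \<omega> * \<phi> j \<omega>)" if ij: "i < n" "j < n" for i j
    using inc ij by (intro integrable_mult_of_squares borel_measurable_integrable) auto
  have orth: "(\<integral>\<omega>. \<phi> i \<omega> * \<phi> j \<omega> \<partial>M) = 0" if ij: "i < n" "j < n" "i \<noteq> j" for i j
  proof -
    have "indep_vars (\<lambda>_. borel) \<phi> {i, j}" using indep_vars_subset[OF indep] ij by auto
    then have "(\<integral>\<omega>. (\<Prod>k\<in>{i, j}. \<phi> k \<omega>) \<partial>M) = (\<Prod>k\<in>{i, j}. \<integral>\<omega>. \<phi> k \<omega> \<partial>M)"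
      using inc(1) ij by (intro indep_vars_lebesgue_integral) auto
    then show ?thesis using ij inc(2) by simp
  qed
  have norm: "(\<integral>\<omega>. \<phi> i \<omega> * \<phi> i \<omega> \<partial>M) = p (Suc i) - p i" if "i < n" for i
    using inc(4)[OF that] by (simp add: power2_eq_square)
  show "integrable M (\<lambda>\<omega>. (\<Sum>i<n. d i * \<phi> i \<omega>)\<^sup>2)"
    and "(\<integral>\<omega>. (\<Sum>i<n. d i * \<phi> i \<omega>)\<^sup>2 \<partial>M) = (\<Sum>i<n. (d i)\<^sup>2 * (p (Suc i) - p i))"
    by (rule integral_square_sum_orthogonal[OF int orth norm]; assumption)+
qed

text \<open>The approximating step functions may use increments of \<open>W\<close> after time \<open>t\<close>. By the isometry these
  contribute nothing in the limit, since \<open>f\<close> vanishes there.\<close>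

lemma wiener_integral_adapted:
  assumes M: "prob_space M" "complete_measure M" and W: "brownian_motion M T W" and t: "t \<in> {0..T}"
    and Y: "has_wiener_integral M T W f Y" and f: "\<And>s. s \<in> {t<..T} \<Longrightarrow> f s = 0"
  shows "Y \<in> borel_measurable (augmented_filtration M W t)"
proof -
  interpret prob_space M by (rule M)
  from Y obtain n :: "nat \<Rightarrow> nat" and p d :: "nat \<Rightarrow> nat \<Rightarrow> real" where
    p: "\<And>k. partition_of T (n k) (p k)" and
    fL2: "(\<lambda>k. LBINT s:{0..T}. ((\<Sum>i<n k. d k i * indicator {p k i<..p k (Suc i)} s) - f s)\<^sup>2) \<longlonglongrightarrow> 0" and
    YL2: "(\<lambda>k. \<integral>\<omega>. ((\<Sum>i<n k. d k i * (W (p k (Suc i)) \<omega> - W (p k i) \<omega>)) - Y \<omega>)\<^sup>2 \<partial>M) \<longlonglongrightarrow> 0"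
    unfolding has_wiener_integral_def partition_of_def by blast
  have ind2: "(indicator A s :: real)\<^sup>2 = indicator A s" for A :: "real set" and s
    by (simp add: indicator_def)
  have mf: "(\<lambda>s. indicator {0..T} s * f s) \<in> borel_measurable lborel"
    and mf2: "integrable lborel (\<lambda>s. (indicator {0..T} s * f s)\<^sup>2)"
    and mY[measurable]: "Y \<in> borel_measurable M" and mY2: "integrable M (\<lambda>\<omega>. (Y \<omega>)\<^sup>2)"
    using Y unfolding has_wiener_integral_def set_borel_measurable_def set_integrable_def
    by (simp_all add: power_mult_distrib ind2)
  have mW[measurable]: "W s \<in> borel_measurable M" if "s \<in> {0..T}" for s
    using W that unfolding brownian_motion_def by blast
  \<comment> \<open>Cutting at \<open>t\<close> splits every step sum into a part using
    \<open>W\<close> up to \<open>t\<close> and a part using it after \<open>t\<close>.\<close>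
  define p1 where "p1 k i = min (p k i) t" for k i
  define p2 where "p2 k i = max (p k i) t" for k i
  have part: "partition_of T (n k) (p1 k)" "partition_of T (n k) (p2 k)" for k
    using p[of k] t unfolding p1_def p2_def partition_of_def by (auto simp: min_le_iff_disj le_max_iff_disj)
  define U where "U p k \<omega> = (\<Sum>i<n k. d k i * (W (p k (Suc i)) \<omega> - W (p k i) \<omega>))" for p k \<omega>
  have W12: "W (p1 k i) \<omega> + W (p2 k i) \<omega> = W (p k i) \<omega> + W t \<omega>" for k i \<omega>
    by (auto simp: p1_def p2_def min_def max_def)
  have U12: "U p1 k \<omega> = U p k \<omega> - U p2 k \<omega>" for k \<omega>
  proof -
    have "W (p1 k (Suc i)) \<omega> - W (p1 k i) \<omega>
      = (W (p k (Suc i)) \<omega> - W (p k i) \<omega>) - (W (p2 k (Suc i)) \<omega> - W (p2 k i) \<omega>)" for i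
      using W12[of k i \<omega>] W12[of k "Suc i" \<omega>] by linarith
    then show ?thesis unfolding U_def by (simp only: right_diff_distrib sum_subtractf)
  qed
  have mU: "U p k \<in> borel_measurable M" "integrable M (\<lambda>\<omega>. (U p k \<omega>)\<^sup>2)"
    if "partition_of T (n k) (p k)" for p k
  proof -
    have "p k i \<in> {0..T}" if "i \<le> n k" for i
      using partition_of_bounds[OF \<open>partition_of T (n k) (p k)\<close> that] by simp
    then show "U p k \<in> borel_measurable M"
      unfolding U_def by (intro borel_measurable_sum borel_measurable_times borel_measurable_diff mW) auto
    show "integrable M (\<lambda>\<omega>. (U p k \<omega>)\<^sup>2)"
      unfolding U_def by (rule wiener_isometry(1)[OF M(1) W that])
  qed
  \<comment> \<open>By the isometry the late part has the norm of the step function restricted to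
    \<open>{t<..T}\<close>. There \<open>f\<close> is zero, so the step function is its own
    approximation error.\<close>
  have tail: "(\<integral>\<omega>. (U p2 k \<omega>)\<^sup>2 \<partial>M)
    \<le> (LBINT s:{0..T}. ((\<Sum>i<n k. d k i * indicator {p k i<..p k (Suc i)} s) - f s)\<^sup>2)" for k
  proof -
    let ?g = "\<lambda>p s. \<Sum>i<n k. d k i * indicator {p k i<..p k (Suc i)} s :: real"
    have "(\<integral>\<omega>. (U p2 k \<omega>)\<^sup>2 \<partial>M) = (\<integral>s. (?g p2 s)\<^sup>2 \<partial>lborel)"
      unfolding U_def wiener_isometry(2)[OF M(1) W part(2)] integral_square_step_function(2)[OF part(2)] ..
    also have "\<dots> \<le> (\<integral>s. indicator {0..T} s *\<^sub>R (?g p s - f s)\<^sup>2 \<partial>lborel)"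
    proof (rule integral_mono)
      show "integrable lborel (\<lambda>s. (?g p2 s)\<^sup>2)"
        by (rule integral_square_step_function(1)[OF part(2)])
      have "integrable lborel (\<lambda>s. (indicator {0..T} s * ?g p s)\<^sup>2)"
        using integrable_mult_indicator[OF _ integral_square_step_function(1)[OF p[of k], of "d k"], of "{0..T}"]
        by (simp add: power_mult_distrib ind2)
      then have "integrable lborel (\<lambda>s. (indicator {0..T} s * ?g p s - indicator {0..T} s * f s)\<^sup>2)"
        by (intro integrable_square_diff mf mf2) measurable
      then show "integrable lborel (\<lambda>s. indicator {0..T} s *\<^sub>R (?g p s - f s)\<^sup>2)"
        by (simp add: power_mult_distrib ind2 flip: right_diff_distrib)
      fix s
      show "(?g p2 s)\<^sup>2 \<le> indicator {0..T} s *\<^sub>R (?g p s - f s)\<^sup>2"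
      proof (cases "s \<in> {t<..T}")
        case True
        then have "?g p2 s = ?g p s"
          by (intro sum.cong refl) (auto simp: p2_def indicator_def)
        then show ?thesis using True f[OF True] t by simp
      next
        case False
        have "?g p2 s = 0"
        proof (rule sum.neutral, rule ballI)
          fix i assume "i \<in> {..<n k}"
          then have "s \<notin> {p2 k i<..p2 k (Suc i)}"
            using False partition_of_bounds[OF part(2), of "Suc i" k] by (auto simp: p2_def)
          then show "d k i * indicator {p2 k i<..p2 k (Suc i)} s = 0" by simp
        qed
        then show ?thesis by simp
      qed
    qed
    finally show ?thesis by (simp add: set_lebesgue_integral_def)
  qed
  have V0: "(\<lambda>k. \<integral>\<omega>. (U p2 k \<omega>)\<^sup>2 \<partial>M) \<longlonglongrightarrow> 0"
    by (rule tendsto_sandwich[OF always_eventually always_eventually tendsto_const fL2]) (use tail in simp_all)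
  have "(\<lambda>k. \<integral>\<omega>. (U p1 k \<omega> - Y \<omega>)\<^sup>2 \<partial>M) \<longlonglongrightarrow> 0"
  proof (rule tendsto_sandwich[OF _ _ tendsto_const])
    show "(\<lambda>k. 2 * (\<integral>\<omega>. (U p k \<omega> - Y \<omega>)\<^sup>2 \<partial>M) + 2 * (\<integral>\<omega>. (U p2 k \<omega>)\<^sup>2 \<partial>M)) \<longlonglongrightarrow> 0"
      using tendsto_add[OF tendsto_mult_left[OF YL2, of 2] tendsto_mult_left[OF V0, of 2]]
      by (simp add: U_def)
    show "eventually (\<lambda>k. (\<integral>\<omega>. (U p1 k \<omega> - Y \<omega>)\<^sup>2 \<partial>M)
      \<le> 2 * (\<integral>\<omega>. (U p k \<omega> - Y \<omega>)\<^sup>2 \<partial>M) + 2 * (\<integral>\<omega>. (U p2 k \<omega>)\<^sup>2 \<partial>M)) sequentially"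
    proof (rule always_eventually, rule allI)
      fix k
      have "(\<integral>\<omega>. (U p1 k \<omega> - Y \<omega>)\<^sup>2 \<partial>M) = (\<integral>\<omega>. ((U p k \<omega> - Y \<omega>) - U p2 k \<omega>)\<^sup>2 \<partial>M)"
        unfolding U12 by (simp add: algebra_simps)
      also have "\<dots> \<le> 2 * (\<integral>\<omega>. (U p k \<omega> - Y \<omega>)\<^sup>2 \<partial>M) + 2 * (\<integral>\<omega>. (U p2 k \<omega>)\<^sup>2 \<partial>M)"
        by (intro integral_square_diff_le borel_measurable_diff integrable_square_diff mU mY mY2 p part)
      finally show "(\<integral>\<omega>. (U p1 k \<omega> - Y \<omega>)\<^sup>2 \<partial>M)
        \<le> 2 * (\<integral>\<omega>. (U p k \<omega> - Y \<omega>)\<^sup>2 \<partial>M) + 2 * (\<integral>\<omega>. (U p2 k \<omega>)\<^sup>2 \<partial>M)" .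
    qed
  qed (auto intro!: always_eventually)
  then have "(\<lambda>k. \<integral>\<omega>. norm ((U p1 k \<omega> - Y \<omega>)\<^sup>2) \<partial>M) \<longlonglongrightarrow> 0" by simp
  moreover have "integrable M (\<lambda>\<omega>. (U p1 k \<omega> - Y \<omega>)\<^sup>2)" for k
    by (rule integrable_square_diff[OF mU(1) mY mU(2) mY2]) (rule part)+
  \<comment> \<open>Mean-square convergence does not give pointwise limits; along a subsequence it
    does almost surely, so \<open>Y\<close> agrees almost everywhere with a limit of variables known
    at time \<open>t\<close>.\<close>
  ultimately obtain r where r: "AE \<omega> in M. (\<lambda>k. (U p1 (r k) \<omega> - Y \<omega>)\<^sup>2) \<longlonglongrightarrow> 0"
    using tendsto_L1_AE_subseq[of M "\<lambda>k \<omega>. (U p1 k \<omega> - Y \<omega>)\<^sup>2"] by blast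
  have mU1: "U p1 k \<in> borel_measurable (augmented_filtration M W t)" for k
  proof -
    have "p1 k i \<in> {0..t}" if "i \<le> n k" for i
      using partition_of_bounds[OF part(1) that] by (simp add: p1_def)
    then show ?thesis
      unfolding U_def
      by (intro borel_measurable_sum borel_measurable_times borel_measurable_diff borel_measurable_augmented_filtration) auto
  qed
  have "(\<lambda>\<omega>. lim (\<lambda>k. U p1 (r k) \<omega>)) \<in> borel_measurable (augmented_filtration M W t)"
    by (intro borel_measurable_lim_metric mU1)
  moreover have "AE \<omega> in M. lim (\<lambda>k. U p1 (r k) \<omega>) = Y \<omega>"
    using r
  proof eventually_elim
    case (elim \<omega>)
    have "(\<lambda>k. \<bar>U p1 (r k) \<omega> - Y \<omega>\<bar>) \<longlonglongrightarrow> 0"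
      using tendsto_real_sqrt[OF elim] by simp
    then have "(\<lambda>k. U p1 (r k) \<omega>) \<longlonglongrightarrow> Y \<omega>"
      by (simp add: tendsto_rabs_zero_iff LIM_zero_iff)
    then show ?case by (rule limI)
  qed
  ultimately show ?thesis
    by (rule borel_measurable_augmented_filtration_AE[OF M(2)])
qed

section \<open>Irregularity of fractional Brownian paths\<close>

lemma (in prob_space) gaussian_rv_square_integrable:
  assumes "gaussian_rv M Y"
  shows "integrable M (\<lambda>\<omega>. (Y \<omega>)\<^sup>2)"
proof -
  have mY[measurable]: "Y \<in> borel_measurable M" using assms by (simp add: gaussian_rv_def)
  consider \<mu> where "AE \<omega> in M. Y \<omega> = \<mu>"
    | \<mu> \<sigma> where "\<sigma> > 0" "distributed M lborel Y (normal_density \<mu> \<sigma>)"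
    using assms by (auto simp: gaussian_rv_def)
  then show ?thesis
  proof cases
    case 1
    have "integrable M (\<lambda>\<omega>. \<mu>\<^sup>2)" by simp
    then show ?thesis
      by (rule integrable_cong_AE_imp) (use 1 in \<open>auto elim: eventually_mono\<close>)
  next
    case 2
    have "integrable M (\<lambda>\<omega>. (Y \<omega> - \<mu>) ^ k)" for k
      using distributed_integrable[OF 2(2), of "\<lambda>x. (x - \<mu>) ^ k"] integrable_normal_moment[OF 2(1), of \<mu> k] by simp
    from this[of 1] this[of 2] have "integrable M (\<lambda>\<omega>. (Y \<omega> - \<mu>)\<^sup>2 + 2 * \<mu> * (Y \<omega> - \<mu>) + \<mu>\<^sup>2)" by simp
    then show ?thesis by (simp add: power2_eq_square algebra_simps)
  qed
qed

lemma (in prob_space) normal_small_ball: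
  assumes D: "distributed M lborel D (normal_density 0 \<sigma>)" and \<sigma>: "0 < \<sigma>" and r: "0 \<le> r"
  shows "emeasure M {\<omega> \<in> space M. \<bar>D \<omega>\<bar> \<le> r} \<le> ennreal (r / \<sigma>)"
proof -
  have "{\<omega> \<in> space M. \<bar>D \<omega>\<bar> \<le> r} = D -` {- r..r} \<inter> space M" by (auto simp: abs_le_iff)
  then have "emeasure M {\<omega> \<in> space M. \<bar>D \<omega>\<bar> \<le> r}
    = (\<integral>\<^sup>+x. ennreal (normal_density 0 \<sigma> x) * indicator {- r..r} x \<partial>lborel)"
    using distributed_emeasure[OF D, of "{- r..r}"] by simp
  also have "\<dots> \<le> (\<integral>\<^sup>+x. ennreal (1 / (2 * \<sigma>)) * indicator {- r..r} x \<partial>lborel)"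
  proof (intro nn_integral_mono mult_right_mono ennreal_leI)
    fix x
    \<comment> \<open>From \<open>2 * pi \<ge> 4\<close> the density is at most
      \<open>1 / (2 * \<sigma>)\<close>; integrating over an interval of length \<open>2 * r\<close>
      gives the clean bound \<open>r / \<sigma>\<close>.\<close>
    have "(2::real)\<^sup>2 \<le> 2 * pi" using pi_gt3 by simp
    then have "(2 * \<sigma>)\<^sup>2 \<le> 2 * pi * \<sigma>\<^sup>2"
      unfolding power_mult_distrib by (rule mult_right_mono) simp
    then have "2 * \<sigma> \<le> sqrt (2 * pi * \<sigma>\<^sup>2)" using \<sigma> by (intro real_le_rsqrt)
    then have "1 / sqrt (2 * pi * \<sigma>\<^sup>2) * exp (- (x - 0)\<^sup>2 / (2 * \<sigma>\<^sup>2)) \<le> 1 / (2 * \<sigma>) * 1"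
      using \<sigma> by (intro mult_mono divide_left_mono) auto
    then show "normal_density 0 \<sigma> x \<le> 1 / (2 * \<sigma>)" by (simp add: normal_density_def)
  qed simp
  also have "\<dots> = ennreal (1 / (2 * \<sigma>)) * ennreal (2 * r)"
    using r by (simp add: nn_integral_cmult)
  also have "\<dots> = ennreal (r / \<sigma>)" using \<sigma> r by (simp flip: ennreal_mult)
  finally show ?thesis .
qed

text \<open>A Gaussian variable is almost surely constant or has a normal density. The covariance
  gives the increment the variance \<open>\<bar>t - s\<bar> powr (2 * H)\<close>, which is positive
  and excludes the first case; the moments fix the parameters in the second.\<close>

lemma fbm_increment:
  assumes M: "prob_space M" and B: "fractional_brownian_motion M T H B"
    and st: "s \<in> {0..T}" "t \<in> {0..T}" "s \<noteq> t"
  shows "distributed M lborel (\<lambda>\<omega>. B t \<omega> - B s \<omega>) (normal_density 0 (\<bar>t - s\<bar> powr H))"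
proof -
  interpret prob_space M by (rule M)
  have gauss: "gaussian_rv M (\<lambda>\<omega>. \<Sum>u\<in>J. c u * B u \<omega>)" if "finite J" "J \<subseteq> {0..T}" for J c
    using B that unfolding fractional_brownian_motion_def gaussian_process_def by blast
  have gB: "gaussian_rv M (B u)" if "u \<in> {0..T}" for u
    using gauss[of "{u}" "\<lambda>_. 1"] that by simp
  have mB[measurable]: "B u \<in> borel_measurable M" if "u \<in> {0..T}" for u
    using gB[OF that] by (simp add: gaussian_rv_def)
  note sqB = gaussian_rv_square_integrable[OF gB]
  have intB: "integrable M (B u)" if "u \<in> {0..T}" for u
    using square_integrable_imp_integrable[OF mB sqB] that by blast
  have EB: "expectation (B u) = 0" if "u \<in> {0..T}" for u
    using B that unfolding fractional_brownian_motion_def by blast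
  have cov: "expectation (\<lambda>\<omega>. B u \<omega> * B v \<omega>) = 1 / 2 * (\<bar>u\<bar> powr (2 * H) + \<bar>v\<bar> powr (2 * H) - \<bar>u - v\<bar> powr (2 * H))"
    if "u \<in> {0..T}" "v \<in> {0..T}" for u v
    using B that unfolding fractional_brownian_motion_def by blast
  define D where "D \<omega> = B t \<omega> - B s \<omega>" for \<omega>
  define \<tau> where "\<tau> = \<bar>t - s\<bar> powr H"
  have \<tau>: "0 < \<tau>" using st by (simp add: \<tau>_def)
  have \<tau>2: "\<tau>\<^sup>2 = \<bar>t - s\<bar> powr (2 * H)"
    unfolding \<tau>_def by (simp add: power2_eq_square flip: powr_add)
  have gD: "gaussian_rv M D"
    using gauss[of "{s, t}" "\<lambda>u. if u = t then 1 else - 1"] st by (simp add: D_def[abs_def])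
  have ED: "expectation D = 0"
    using intB EB st unfolding D_def[abs_def] by simp
  have ED2: "expectation (\<lambda>\<omega>. (D \<omega>)\<^sup>2) = \<tau>\<^sup>2"
  proof -
    have "integrable M (\<lambda>\<omega>. B u \<omega> * B v \<omega>)" if "u \<in> {0..T}" "v \<in> {0..T}" for u v
      using that by (intro integrable_mult_of_squares mB sqB)
    moreover have "(\<lambda>\<omega>. (D \<omega>)\<^sup>2) = (\<lambda>\<omega>. B t \<omega> * B t \<omega> - 2 * (B t \<omega> * B s \<omega>) + B s \<omega> * B s \<omega>)"
      by (simp add: D_def power2_eq_square algebra_simps)
    ultimately have "expectation (\<lambda>\<omega>. (D \<omega>)\<^sup>2) = expectation (\<lambda>\<omega>. B t \<omega> * B t \<omega>)
      - 2 * expectation (\<lambda>\<omega>. B t \<omega> * B s \<omega>) + expectation (\<lambda>\<omega>. B s \<omega> * B s \<omega>)"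
      using st by simp
    also have "\<dots> = \<tau>\<^sup>2" unfolding \<tau>2 using st by (simp add: cov diff_divide_distrib add_divide_distrib)
    finally show ?thesis .
  qed
  have mD: "D \<in> borel_measurable M" using gD by (simp add: gaussian_rv_def)
  consider \<mu> where "AE \<omega> in M. D \<omega> = \<mu>"
    | \<mu> \<sigma> where "\<sigma> > 0" "distributed M lborel D (normal_density \<mu> \<sigma>)"
    using gD by (auto simp: gaussian_rv_def)
  then have "distributed M lborel D (normal_density 0 \<tau>)"
  proof cases
    case 1
    have "expectation D = expectation (\<lambda>\<omega>. \<mu>)"
      by (rule integral_cong_AE) (use 1 mD in auto)
    then have "\<mu> = 0" using ED by (simp add: prob_space)
    have "expectation (\<lambda>\<omega>. (D \<omega>)\<^sup>2) = expectation (\<lambda>\<omega>. 0)"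
      by (rule integral_cong_AE) (use 1 mD \<open>\<mu> = 0\<close> in \<open>auto elim: eventually_mono\<close>)
    then show ?thesis using ED2 \<tau> by simp
  next
    case 2
    have "\<mu> = 0" using normal_distributed_expectation[OF 2] ED by simp
    moreover have "\<sigma>\<^sup>2 = \<tau>\<^sup>2" using normal_distributed_variance[OF 2] ED ED2 by simp
    then have "\<sigma> = \<tau>" using 2(1) \<tau> by (simp add: power2_eq_iff)
    ultimately show ?thesis using 2(2) by simp
  qed
  then show ?thesis by (simp add: D_def[abs_def] \<tau>_def)
qed

section \<open>The area of near-diagonal Lipschitz pairs\<close>

text \<open>Cauchy-Schwarz over the pieces of \<open>A\<close> in \<open>n + 1\<close> consecutive blocks of length \<open>T / n\<close>.\<close>

lemma square_measure_le_near_diagonal: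
  fixes A :: "real set"
  assumes A[measurable]: "A \<in> sets lborel" and AT: "A \<subseteq> {0..T}" and T: "0 < T" and n: "0 < n"
    and g: "\<And>s t. s \<in> A \<Longrightarrow> t \<in> A \<Longrightarrow> \<bar>s - t\<bar> \<le> T / real n \<Longrightarrow> 1 \<le> (g s t :: ennreal)"
  shows "ennreal ((measure lborel A)\<^sup>2) \<le> ennreal (real (n + 1)) * (\<integral>\<^sup>+s. \<integral>\<^sup>+t. g s t \<partial>lborel \<partial>lborel)"
proof -
  define h where "h = T / real n"
  have h: "0 < h" using T n by (simp add: h_def)
  \<comment> \<open>Half-open blocks make the pieces disjoint; the block with index \<open>n\<close>
    is there for the point \<open>T\<close>. Two points of one block are within \<open>h\<close>, so
    \<open>g\<close> dominates the indicator of the union of the squares of the pieces.\<close>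
  define P where "P i = A \<inter> {real i * h..<real (Suc i) * h}" for i
  have P[measurable]: "P i \<in> sets lborel" for i unfolding P_def by measurable
  have disj: "i = j" if "s \<in> P i" "s \<in> P j" for s i j
  proof (rule ccontr)
    assume "i \<noteq> j"
    then have "Suc i \<le> j \<or> Suc j \<le> i" by linarith
    then have "real (Suc i) * h \<le> real j * h \<or> real (Suc j) * h \<le> real i * h"
      using h by (auto intro!: mult_right_mono simp del: of_nat_Suc)
    then show False using that by (auto simp: P_def)
  qed
  have A_eq: "A = (\<Union>i\<le>n. P i)"
  proof safe
    fix s assume s: "s \<in> A"
    define i where "i = nat \<lfloor>s / h\<rfloor>"
    have s0: "0 \<le> s" "s \<le> T" using s AT by auto
    have i: "real i \<le> s / h" "s / h < real i + 1" using s0 h by (auto simp: i_def)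
    have "s / h \<le> T / h" using s0 h by (intro divide_right_mono) auto
    also have "T / h = real n" using T n by (simp add: h_def)
    finally have "i \<le> n" using i(1) by linarith
    moreover have "s \<in> P i" using i s h by (simp add: P_def pos_le_divide_eq pos_divide_less_eq algebra_simps)
    ultimately show "s \<in> (\<Union>i\<le>n. P i)" by blast
  qed (auto simp: P_def)
  have finP: "emeasure lborel (P i) < \<infinity>" for i
    by (rule emeasure_bounded_finite, rule bounded_subset[OF bounded_closed_interval[of 0 T]]) (use AT in \<open>auto simp: P_def\<close>)
  have "measure lborel A = (\<Sum>i\<le>n. measure lborel (P i))"
    unfolding A_eq using finP disj
    by (intro measure_finite_Union) (auto simp: disjoint_family_on_def less_top[symmetric] top_unique P[simplified])
  then have "(measure lborel A)\<^sup>2 \<le> (\<Sum>i\<le>n. (measure lborel (P i))\<^sup>2) * real (card {..n})"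
    using sum_squared_le_sum_of_squares[of "\<lambda>i. measure lborel (P i)" "{..n}"] by simp
  then have "ennreal ((measure lborel A)\<^sup>2) \<le> ennreal (real (n + 1)) * ennreal (\<Sum>i\<le>n. (measure lborel (P i))\<^sup>2)"
    by (subst ennreal_mult[symmetric]) (auto simp: sum_nonneg mult.commute intro!: ennreal_leI)
  also have "ennreal (\<Sum>i\<le>n. (measure lborel (P i))\<^sup>2) = (\<Sum>i\<le>n. emeasure lborel (P i) * emeasure lborel (P i))"
  proof -
    have "emeasure lborel (P i) = ennreal (measure lborel (P i))" for i
      using finP[of i] by (intro emeasure_eq_ennreal_measure) simp
    then have "emeasure lborel (P i) * emeasure lborel (P i) = ennreal ((measure lborel (P i))\<^sup>2)" for i
      by (simp only: power2_eq_square ennreal_mult measure_nonneg)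
    then show ?thesis by (simp only: sum_ennreal[OF zero_le_power2])
  qed
  also have "\<dots> = (\<integral>\<^sup>+s. (\<integral>\<^sup>+t. (\<Sum>i\<le>n. indicator (P i) s * indicator (P i) t) \<partial>lborel) \<partial>lborel)"
  proof -
    have inner: "(\<integral>\<^sup>+t. (\<Sum>i\<le>n. indicator (P i) s * indicator (P i) t) \<partial>lborel)
      = (\<Sum>i\<le>n. indicator (P i) s * emeasure lborel (P i))" for s
    proof (subst nn_integral_sum)
      show "(\<Sum>i\<le>n. \<integral>\<^sup>+t. indicator (P i) s * indicator (P i) t \<partial>lborel)
        = (\<Sum>i\<le>n. indicator (P i) s * emeasure lborel (P i))"
        by (intro sum.cong refl nn_integral_cmult_indicator P)
    qed (use P in simp)
    have "(\<integral>\<^sup>+s. (\<Sum>i\<le>n. indicator (P i) s * emeasure lborel (P i)) \<partial>lborel)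
      = (\<Sum>i\<le>n. \<integral>\<^sup>+s. indicator (P i) s * emeasure lborel (P i) \<partial>lborel)"
      using P by (intro nn_integral_sum) simp
    also have "\<dots> = (\<Sum>i\<le>n. emeasure lborel (P i) * emeasure lborel (P i))"
      using P by (intro sum.cong refl, subst nn_integral_multc) simp_all
    finally show ?thesis unfolding inner by (rule sym)
  qed
  also have "\<dots> \<le> (\<integral>\<^sup>+s. \<integral>\<^sup>+t. g s t \<partial>lborel \<partial>lborel)"
  proof (intro nn_integral_mono)
    fix s t
    show "(\<Sum>i\<le>n. indicator (P i) s * indicator (P i) t) \<le> g s t"
    proof (cases "\<exists>j\<le>n. s \<in> P j \<and> t \<in> P j")
      case True
      then obtain j where j: "j \<le> n" "s \<in> P j" "t \<in> P j" by blast
      have "(\<Sum>i\<le>n. indicator (P i) s * indicator (P i) t) = (\<Sum>i\<le>n. if i = j then 1 else 0 :: ennreal)"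
        using j disj by (intro sum.cong) (auto simp: indicator_def)
      also have "\<dots> = 1" using j by simp
      also have "1 \<le> g s t"
      proof (rule g)
        show "\<bar>s - t\<bar> \<le> T / real n"
          using j unfolding P_def h_def[symmetric] by (auto simp: abs_le_iff algebra_simps)
      qed (use j in \<open>auto simp: P_def\<close>)
      finally show ?thesis .
    next
      case False
      then have "(\<Sum>i\<le>n. indicator (P i) s * indicator (P i) t :: ennreal) = 0"
        by (intro sum.neutral) (auto simp: indicator_def)
      then show ?thesis by simp
    qed
  qed
  finally show ?thesis by (simp add: mult_left_mono)
qed

text \<open>Tonelli moves the expectation inside. A pair then contributes at most K * |s - t| powr
  (1 - H), which is at most K * h powr (1 - H) because \<open>H < 1\<close>, and the strip has area
  at most 2 * h * T. Clamped times in \<open>g\<close> make the integrand jointly measurable without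
  affecting its values.\<close>

lemma nn_integral_near_diagonal_le:
  fixes Z :: "real \<Rightarrow> 'a \<Rightarrow> real" and T H K :: real
  assumes M: "prob_space M" and T: "0 < T" and H: "H < 1" and K: "0 \<le> K" and h: "0 < h"
    and mZ: "\<And>t. t \<in> {0..T} \<Longrightarrow> Z t \<in> borel_measurable M"
    and cont: "\<And>\<omega>. \<omega> \<in> space M \<Longrightarrow> continuous_on {0..T} (\<lambda>t. Z t \<omega>)"
    and small: "\<And>s t r. s \<in> {0..T} \<Longrightarrow> t \<in> {0..T} \<Longrightarrow> s \<noteq> t \<Longrightarrow> 0 \<le> r \<Longrightarrow>
      emeasure M {\<omega> \<in> space M. \<bar>Z s \<omega> - Z t \<omega>\<bar> \<le> r} \<le> ennreal (r / \<bar>s - t\<bar> powr H)"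
  defines "g \<equiv> \<lambda>\<omega> s t. if s \<in> {0..T} \<and> t \<in> {0..T} \<and> \<bar>s - t\<bar> \<le> h \<and>
      \<bar>Z (max 0 (min T s)) \<omega> - Z (max 0 (min T t)) \<omega>\<bar> \<le> K * \<bar>s - t\<bar> then 1 else 0 :: ennreal"
  shows "(\<lambda>\<omega>. \<integral>\<^sup>+s. \<integral>\<^sup>+t. g \<omega> s t \<partial>lborel \<partial>lborel) \<in> borel_measurable M"
    and "(\<integral>\<^sup>+\<omega>. \<integral>\<^sup>+s. \<integral>\<^sup>+t. g \<omega> s t \<partial>lborel \<partial>lborel \<partial>M) \<le> ennreal (2 * T * K * h * h powr (1 - H))"
proof -
  interpret prob_space M by (rule M)
  interpret MT: pair_sigma_finite M "lborel :: real measure" ..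
  let ?c = "\<lambda>s. max 0 (min T s)"
  have Zc: "(\<lambda>z. Z (?c (snd z)) (fst z)) \<in> borel_measurable (M \<Otimes>\<^sub>M lborel)"
    using borel_measurable_continuous_process[OF mZ less_imp_le[OF T] cont] by (simp add: case_prod_beta)
  have [measurable]: "(\<lambda>z. Z (?c (snd (fst z))) (fst (fst z))) \<in> borel_measurable ((M \<Otimes>\<^sub>M lborel) \<Otimes>\<^sub>M lborel)"
    by (rule measurable_compose[OF measurable_fst Zc])
  have "(\<lambda>z. (fst (fst z), snd z)) \<in> measurable ((M \<Otimes>\<^sub>M lborel) \<Otimes>\<^sub>M (lborel :: real measure)) (M \<Otimes>\<^sub>M lborel)"
    by measurable
  from measurable_compose[OF this Zc]
  have [measurable]: "(\<lambda>z. Z (?c (snd z)) (fst (fst z))) \<in> borel_measurable ((M \<Otimes>\<^sub>M (lborel :: real measure)) \<Otimes>\<^sub>M lborel)"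
    by simp
  have mg: "(\<lambda>z. g (fst (fst z)) (snd (fst z)) (snd z)) \<in> borel_measurable ((M \<Otimes>\<^sub>M lborel) \<Otimes>\<^sub>M lborel)"
    unfolding g_def by measurable
  have mgt: "(\<lambda>z. \<integral>\<^sup>+t. g (fst z) (snd z) t \<partial>lborel) \<in> borel_measurable (M \<Otimes>\<^sub>M lborel)"
    using mg by (intro lborel.borel_measurable_nn_integral) (simp add: case_prod_beta)
  show "(\<lambda>\<omega>. \<integral>\<^sup>+s. \<integral>\<^sup>+t. g \<omega> s t \<partial>lborel \<partial>lborel) \<in> borel_measurable M"
    using mgt by (intro lborel.borel_measurable_nn_integral) (simp add: case_prod_beta)
  have mgs: "(\<lambda>z. g (fst z) s (snd z)) \<in> borel_measurable (M \<Otimes>\<^sub>M lborel)" for s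
  proof -
    have "(\<lambda>z. ((fst z, s), snd z)) \<in> measurable (M \<Otimes>\<^sub>M (lborel :: real measure)) ((M \<Otimes>\<^sub>M (lborel :: real measure)) \<Otimes>\<^sub>M lborel)"
      by measurable
    from measurable_compose[OF this mg] show ?thesis by simp
  qed
  have bound: "(\<integral>\<^sup>+\<omega>. g \<omega> s t \<partial>M) \<le> indicator {0..T} s * (ennreal (K * h powr (1 - H)) * indicator {s - h..s + h} t)"
    if st: "s \<noteq> t" for s t
  proof (cases "s \<in> {0..T} \<and> t \<in> {0..T} \<and> \<bar>s - t\<bar> \<le> h")
    case True
    have c: "?c s = s" "?c t = t" using True by auto
    have "(\<integral>\<^sup>+\<omega>. g \<omega> s t \<partial>M) = (\<integral>\<^sup>+\<omega>. indicator {\<omega> \<in> space M. \<bar>Z s \<omega> - Z t \<omega>\<bar> \<le> K * \<bar>s - t\<bar>} \<omega> \<partial>M)"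
      unfolding g_def c using True by (intro nn_integral_cong) (auto simp: indicator_def)
    also have "\<dots> = emeasure M {\<omega> \<in> space M. \<bar>Z s \<omega> - Z t \<omega>\<bar> \<le> K * \<bar>s - t\<bar>}"
    proof (rule nn_integral_indicator)
      have [measurable]: "Z s \<in> borel_measurable M" "Z t \<in> borel_measurable M"
        using True mZ by blast+
      show "{\<omega> \<in> space M. \<bar>Z s \<omega> - Z t \<omega>\<bar> \<le> K * \<bar>s - t\<bar>} \<in> sets M" by measurable
    qed
    also have "\<dots> \<le> ennreal (K * \<bar>s - t\<bar> / \<bar>s - t\<bar> powr H)"
      using True K st by (intro small) auto
    also have "K * \<bar>s - t\<bar> / \<bar>s - t\<bar> powr H = K * \<bar>s - t\<bar> powr (1 - H)"
      using st by (simp add: powr_diff)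
    also have "\<dots> \<le> K * h powr (1 - H)"
      using True K H by (intro mult_left_mono powr_mono2) auto
    finally show ?thesis using True by (auto simp: abs_le_iff indicator_def ennreal_leI)
  next
    case False
    then have "g \<omega> s t = 0" for \<omega> by (auto simp: g_def)
    then show ?thesis by simp
  qed
  have "(\<integral>\<^sup>+\<omega>. \<integral>\<^sup>+s. \<integral>\<^sup>+t. g \<omega> s t \<partial>lborel \<partial>lborel \<partial>M) = (\<integral>\<^sup>+s. \<integral>\<^sup>+\<omega>. \<integral>\<^sup>+t. g \<omega> s t \<partial>lborel \<partial>M \<partial>lborel)"
    using MT.Fubini'[of "\<lambda>\<omega> s. \<integral>\<^sup>+t. g \<omega> s t \<partial>lborel"] mgt by (simp add: case_prod_beta)
  also have "\<dots> = (\<integral>\<^sup>+s. \<integral>\<^sup>+t. \<integral>\<^sup>+\<omega>. g \<omega> s t \<partial>M \<partial>lborel \<partial>lborel)"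
  proof (rule nn_integral_cong)
    fix s
    show "(\<integral>\<^sup>+\<omega>. \<integral>\<^sup>+t. g \<omega> s t \<partial>lborel \<partial>M) = (\<integral>\<^sup>+t. \<integral>\<^sup>+\<omega>. g \<omega> s t \<partial>M \<partial>lborel)"
      using MT.Fubini'[of "\<lambda>\<omega> t. g \<omega> s t"] mgs[of s] by (simp add: case_prod_beta)
  qed
  also have "\<dots> \<le> (\<integral>\<^sup>+s. \<integral>\<^sup>+t. indicator {0..T} s * (ennreal (K * h powr (1 - H)) * indicator {s - h..s + h} t) \<partial>lborel \<partial>lborel)"
  proof (rule nn_integral_mono, rule nn_integral_mono_AE)
    fix s
    \<comment> \<open>On the diagonal the Lipschitz condition always holds and the bound can fail,
      but for each \<open>s\<close> this is a single point \<open>t\<close>.\<close>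
    show "AE t in lborel. (\<integral>\<^sup>+\<omega>. g \<omega> s t \<partial>M)
      \<le> indicator {0..T} s * (ennreal (K * h powr (1 - H)) * indicator {s - h..s + h} t)"
      using AE_lborel_singleton[of s] by (rule eventually_mono) (rule bound, simp)
  qed
  also have "\<dots> = (\<integral>\<^sup>+s. ennreal (K * h powr (1 - H) * (2 * h)) * indicator {0..T} s \<partial>lborel)"
  proof (rule nn_integral_cong)
    fix s
    have "(\<integral>\<^sup>+t. indicator {0..T} s * (ennreal (K * h powr (1 - H)) * indicator {s - h..s + h} t) \<partial>lborel)
      = indicator {0..T} s * (ennreal (K * h powr (1 - H)) * ennreal (2 * h))"
      using h by (simp add: nn_integral_cmult)
    also have "ennreal (K * h powr (1 - H)) * ennreal (2 * h) = ennreal (K * h powr (1 - H) * (2 * h))"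
      using K h by (intro ennreal_mult[symmetric]) auto
    finally show "(\<integral>\<^sup>+t. indicator {0..T} s * (ennreal (K * h powr (1 - H)) * indicator {s - h..s + h} t) \<partial>lborel)
      = ennreal (K * h powr (1 - H) * (2 * h)) * indicator {0..T} s" by (simp only: mult.commute)
  qed
  also have "\<dots> = ennreal (K * h powr (1 - H) * (2 * h)) * ennreal T"
    using T by (simp add: nn_integral_cmult_indicator)
  also have "\<dots> = ennreal (2 * T * K * h * h powr (1 - H))"
    using K h T by (subst ennreal_mult[symmetric]) (auto simp: mult_ac)
  finally show "(\<integral>\<^sup>+\<omega>. \<integral>\<^sup>+s. \<integral>\<^sup>+t. g \<omega> s t \<partial>lborel \<partial>lborel \<partial>M) \<le> ennreal (2 * T * K * h * h powr (1 - H))" .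
qed

text \<open>The variables \<open>u n\<close> below dominate the squared measure of every admissible
  \<open>A\<close> simultaneously, and their means tend to 0. Hence one null event covers
  uncountably many sets \<open>A\<close>, including sets chosen depending on the path.\<close>

lemma AE_lipschitz_sets_measure_0:
  fixes Z :: "real \<Rightarrow> 'a \<Rightarrow> real" and T H K :: real
  assumes M: "prob_space M" and T: "0 < T" and H: "H < 1" and K: "0 \<le> K"
    and mZ: "\<And>t. t \<in> {0..T} \<Longrightarrow> Z t \<in> borel_measurable M"
    and cont: "\<And>\<omega>. \<omega> \<in> space M \<Longrightarrow> continuous_on {0..T} (\<lambda>t. Z t \<omega>)"
    and small: "\<And>s t r. s \<in> {0..T} \<Longrightarrow> t \<in> {0..T} \<Longrightarrow> s \<noteq> t \<Longrightarrow> 0 \<le> r \<Longrightarrow>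
      emeasure M {\<omega> \<in> space M. \<bar>Z s \<omega> - Z t \<omega>\<bar> \<le> r} \<le> ennreal (r / \<bar>s - t\<bar> powr H)"
  shows "AE \<omega> in M. \<forall>A\<in>sets lborel. A \<subseteq> {0..T} \<longrightarrow>
    (\<forall>s\<in>A. \<forall>t\<in>A. \<bar>Z s \<omega> - Z t \<omega>\<bar> \<le> K * \<bar>s - t\<bar>) \<longrightarrow> measure lborel A = 0"
proof -
  define g where "g n \<omega> s t = (if s \<in> {0..T} \<and> t \<in> {0..T} \<and> \<bar>s - t\<bar> \<le> T / real (Suc n) \<and>
      \<bar>Z (max 0 (min T s)) \<omega> - Z (max 0 (min T t)) \<omega>\<bar> \<le> K * \<bar>s - t\<bar> then 1 else 0 :: ennreal)" for n \<omega> s t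
  \<comment> \<open>The factor counts the blocks: \<open>Suc n\<close> of length
    \<open>T / Suc n\<close>, and one more for the end point.\<close>
  define u where "u n \<omega> = ennreal (real (Suc n + 1)) * (\<integral>\<^sup>+s. \<integral>\<^sup>+t. g n \<omega> s t \<partial>lborel \<partial>lborel)" for n \<omega>
  have hpos: "0 < T / real (Suc n)" for n using T by simp
  note gint = nn_integral_near_diagonal_le[where T = T, OF M T H K hpos mZ cont small, folded g_def]
  have mu[measurable]: "u n \<in> borel_measurable M" for n
    unfolding u_def[abs_def] by (intro borel_measurable_times_ennreal borel_measurable_const gint(1))
  have le: "(\<integral>\<^sup>+\<omega>. u n \<omega> \<partial>M) \<le> ennreal (4 * T * T * K * (T / real (Suc n)) powr (1 - H))" for n
  proof -
    let ?h = "T / real (Suc n)"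
    have "(\<integral>\<^sup>+\<omega>. u n \<omega> \<partial>M) = ennreal (real (Suc n + 1)) * (\<integral>\<^sup>+\<omega>. \<integral>\<^sup>+s. \<integral>\<^sup>+t. g n \<omega> s t \<partial>lborel \<partial>lborel \<partial>M)"
      unfolding u_def by (rule nn_integral_cmult[OF gint(1)])
    also have "\<dots> \<le> ennreal (real (Suc n + 1)) * ennreal (2 * T * K * ?h * ?h powr (1 - H))"
      by (rule mult_left_mono[OF gint(2) zero_le])
    also have "\<dots> = ennreal (real (Suc n + 1) * (2 * T * K * ?h * ?h powr (1 - H)))"
      using T K by (intro ennreal_mult[symmetric]) auto
    also have "\<dots> \<le> ennreal (4 * T * T * K * ?h powr (1 - H))"
    proof (rule ennreal_leI)
      have "real (Suc n + 1) * ?h \<le> (2 * real (Suc n)) * ?h" using T by (intro mult_right_mono) auto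
      also have "\<dots> = 2 * T" by (simp del: of_nat_Suc)
      finally have "(real (Suc n + 1) * ?h) * (2 * T * K * ?h powr (1 - H)) \<le> (2 * T) * (2 * T * K * ?h powr (1 - H))"
        using T K by (intro mult_right_mono) auto
      then show "real (Suc n + 1) * (2 * T * K * ?h * ?h powr (1 - H)) \<le> 4 * T * T * K * ?h powr (1 - H)"
        by (simp only: mult_ac)
    qed
    finally show ?thesis .
  qed
  have "(\<lambda>n. T / real (Suc n)) \<longlonglongrightarrow> 0"
    using tendsto_mult_left[OF LIMSEQ_inverse_real_of_nat, of T] by (simp add: divide_inverse)
  then have "(\<lambda>n. (T / real (Suc n)) powr (1 - H)) \<longlonglongrightarrow> 0 powr (1 - H)"
    using H T by (intro tendsto_powr' tendsto_const) (auto intro!: always_eventually)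
  then have "(\<lambda>n. 4 * T * T * K * (T / real (Suc n)) powr (1 - H)) \<longlonglongrightarrow> 4 * T * T * K * 0 powr (1 - H)"
    by (rule tendsto_mult_left)
  from tendsto_ennrealI[OF this]
  have "(\<lambda>n. ennreal (4 * T * T * K * (T / real (Suc n)) powr (1 - H))) \<longlonglongrightarrow> 0"
    by (simp del: of_nat_Suc)
  then have lim0: "(\<lambda>n. \<integral>\<^sup>+\<omega>. u n \<omega> \<partial>M) \<longlonglongrightarrow> 0"
    by (rule tendsto_sandwich[OF always_eventually always_eventually tendsto_const, rotated 2])
       (use le in simp_all)
  \<comment> \<open>By Fatou's lemma, means tending to 0 force the lower limit to vanish almost
    surely. That is enough, since the squared measure lies below every \<open>u n\<close>.\<close>
  have "(\<integral>\<^sup>+\<omega>. liminf (\<lambda>n. u n \<omega>) \<partial>M) \<le> liminf (\<lambda>n. \<integral>\<^sup>+\<omega>. u n \<omega> \<partial>M)"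
    by (rule nn_integral_liminf) (rule mu)
  also have "\<dots> = 0" using lim_imp_Liminf[OF _ lim0] by simp
  finally have "(\<integral>\<^sup>+\<omega>. liminf (\<lambda>n. u n \<omega>) \<partial>M) = 0" by simp
  then have "AE \<omega> in M. liminf (\<lambda>n. u n \<omega>) = 0"
    by (subst (asm) nn_integral_0_iff_AE) measurable
  then show ?thesis
  proof eventually_elim
    case (elim \<omega>)
    show ?case
    proof (intro ballI impI)
      fix A :: "real set"
      assume A: "A \<in> sets lborel" "A \<subseteq> {0..T}" and lip: "\<forall>s\<in>A. \<forall>t\<in>A. \<bar>Z s \<omega> - Z t \<omega>\<bar> \<le> K * \<bar>s - t\<bar>"
      have "ennreal ((measure lborel A)\<^sup>2) \<le> u n \<omega>" for n
        unfolding u_def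
      proof (rule square_measure_le_near_diagonal[OF A T])
        fix s t assume st: "s \<in> A" "t \<in> A" "\<bar>s - t\<bar> \<le> T / real (Suc n)"
        then have "s \<in> {0..T}" "t \<in> {0..T}" using A by auto
        moreover from this have "max 0 (min T s) = s" "max 0 (min T t) = t" by auto
        ultimately have "g n \<omega> s t = 1" using st lip by (simp add: g_def)
        then show "1 \<le> g n \<omega> s t" by simp
      qed simp
      then have "ennreal ((measure lborel A)\<^sup>2) \<le> liminf (\<lambda>n. u n \<omega>)"
        by (intro Liminf_bounded always_eventually) simp
      then show "measure lborel A = 0" using elim by (simp add: ennreal_eq_0_iff)
    qed
  qed
qed

text \<open>Natural numbers as Lipschitz constants reduce all \<open>K\<close> to countably many
  exceptional events. \<open>Z\<close> stands for a version of \<open>B\<close> with every path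
  continuous, as joint measurability requires.\<close>

lemma AE_null_lipschitz_sets:
  fixes Z :: "real \<Rightarrow> 'a \<Rightarrow> real" and T H :: real
  assumes M: "prob_space M" and B: "fractional_brownian_motion M T H B" and T: "0 < T" and H: "H < 1"
    and mZ: "\<And>t. t \<in> {0..T} \<Longrightarrow> Z t \<in> borel_measurable M"
    and cont: "\<And>\<omega>. \<omega> \<in> space M \<Longrightarrow> continuous_on {0..T} (\<lambda>t. Z t \<omega>)"
    and ZB: "AE \<omega> in M. \<forall>t\<in>{0..T}. Z t \<omega> = B t \<omega>"
  shows "AE \<omega> in M. null_lipschitz_sets T (\<lambda>t. Z t \<omega>)"
proof -
  interpret prob_space M by (rule M)
  have small: "emeasure M {\<omega> \<in> space M. \<bar>Z s \<omega> - Z t \<omega>\<bar> \<le> r} \<le> ennreal (r / \<bar>s - t\<bar> powr H)"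
    if st: "s \<in> {0..T}" "t \<in> {0..T}" "s \<noteq> t" and r: "0 \<le> r" for s t r
  proof -
    have D: "distributed M lborel (\<lambda>\<omega>. B s \<omega> - B t \<omega>) (normal_density 0 (\<bar>s - t\<bar> powr H))"
      using fbm_increment[OF M B st(2,1)] st(3) by simp
    have [measurable]: "Z s \<in> borel_measurable M" "Z t \<in> borel_measurable M" "(\<lambda>\<omega>. B s \<omega> - B t \<omega>) \<in> borel_measurable M"
      using mZ st distributed_measurable[OF D] by auto
    have "emeasure M {\<omega> \<in> space M. \<bar>Z s \<omega> - Z t \<omega>\<bar> \<le> r} = emeasure M {\<omega> \<in> space M. \<bar>B s \<omega> - B t \<omega>\<bar> \<le> r}"
    proof (rule emeasure_eq_AE)
      show "AE \<omega> in M. \<omega> \<in> {\<omega> \<in> space M. \<bar>Z s \<omega> - Z t \<omega>\<bar> \<le> r} \<longleftrightarrow> \<omega> \<in> {\<omega> \<in> space M. \<bar>B s \<omega> - B t \<omega>\<bar> \<le> r}"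
        using ZB by eventually_elim (use st in simp)
    qed measurable
    also have "\<dots> \<le> ennreal (r / \<bar>s - t\<bar> powr H)"
      by (rule normal_small_ball[OF D _ r]) (use st in simp)
    finally show ?thesis .
  qed
  have "AE \<omega> in M. \<forall>k::nat. \<forall>A\<in>sets lborel. A \<subseteq> {0..T} \<longrightarrow>
    (\<forall>s\<in>A. \<forall>t\<in>A. \<bar>Z s \<omega> - Z t \<omega>\<bar> \<le> real k * \<bar>s - t\<bar>) \<longrightarrow> measure lborel A = 0"
    unfolding AE_all_countable
    by (rule allI, rule AE_lipschitz_sets_measure_0[OF M T H of_nat_0_le_iff mZ cont small])
  then show ?thesis
  proof eventually_elim
    case (elim \<omega>)
    show ?case
      unfolding null_lipschitz_sets_def
    proof (intro allI ballI impI)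
      fix K and A :: "real set"
      assume A: "A \<in> sets lborel" "A \<subseteq> {0..T}" and lip: "\<forall>s\<in>A. \<forall>t\<in>A. \<bar>Z s \<omega> - Z t \<omega>\<bar> \<le> K * \<bar>s - t\<bar>"
      obtain k :: nat where k: "K \<le> real k" using real_arch_simple by blast
      have "\<bar>Z s \<omega> - Z t \<omega>\<bar> \<le> real k * \<bar>s - t\<bar>" if "s \<in> A" "t \<in> A" for s t
      proof -
        have "\<bar>Z s \<omega> - Z t \<omega>\<bar> \<le> K * \<bar>s - t\<bar>" using lip that by blast
        also have "\<dots> \<le> real k * \<bar>s - t\<bar>" using k by (intro mult_right_mono) auto
        finally show ?thesis .
      qed
      with elim A have "measure lborel A = 0" by blast
      \<comment> \<open>\<open>measure\<close> is 0 on sets of infinite measure as well, so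
        finiteness has to be supplied to obtain a null set.\<close>
      moreover have "emeasure lborel A < \<infinity>"
        by (rule emeasure_bounded_finite, rule bounded_subset[OF bounded_closed_interval A(2)])
      ultimately show "A \<in> null_sets lborel"
        using A(1) by (intro null_setsI) (simp_all add: emeasure_eq_ennreal_measure)
    qed
  qed
qed

section \<open>The stochastic differential equation\<close>

text \<open>Freezing the drift outside \<open>{0..T}\<close> turns measurability on the restricted
  space into measurability on the whole plane, which the path lemmas expect.\<close>

lemma drift_measurable_clamp:
  assumes "drift_measurable T b" "0 \<le> T"
  shows "case_prod (\<lambda>s. b (max 0 (min T s))) \<in> borel_measurable (borel \<Otimes>\<^sub>M borel)"
proof -
  have "(\<lambda>s. max 0 (min T s)) \<in> measurable borel (restrict_space borel {0..T})"
    using assms(2) by (intro measurable_restrict_space2) auto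
  then have "(\<lambda>z. (max 0 (min T (fst z)), snd z)) \<in> measurable (borel \<Otimes>\<^sub>M borel) (restrict_space borel {0..T} \<Otimes>\<^sub>M (borel :: real measure))"
    by (intro measurable_Pair measurable_snd) (rule measurable_compose[OF measurable_fst])
  from measurable_compose[OF this assms(1)[unfolded drift_measurable_def]] show ?thesis
    by (simp add: case_prod_beta)
qed

lemma drift_measurable_const [simp]: "drift_measurable T (\<lambda>_ _. k)"
  by (simp add: drift_measurable_def case_prod_beta)

lemma piecewise_uniformly_continuous_isCont:
  assumes g: "piecewise_uniformly_continuous m a g" and x: "x \<notin> a ` {1..m}"
  shows "isCont g x"
proof -
  \<comment> \<open>The largest index in \<open>J\<close> numbers the open interval containing
    \<open>x\<close>; the inserted 0 stands for the interval unbounded to the left.\<close>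
  define J where "J = insert 0 {j \<in> {1..m}. a j < x}"
  define i where "i = Max J"
  have fin: "finite J" by (simp add: J_def)
  have iJ: "i \<in> J" unfolding i_def using fin by (intro Max_in) (auto simp: J_def)
  have upper: "x < a (Suc i)" if "i < m"
  proof (rule ccontr)
    assume "\<not> x < a (Suc i)"
    moreover have "a (Suc i) \<noteq> x" using x that by auto
    ultimately have "Suc i \<in> J" using that by (auto simp: J_def)
    then have "Suc i \<le> i" unfolding i_def using fin by (rule Max_ge[rotated])
    then show False by simp
  qed
  define I where "I = {x. (1 \<le> i \<longrightarrow> a i < x) \<and> (i < m \<longrightarrow> x < a (Suc i))}"
  have "I = (if 1 \<le> i then {a i<..} else UNIV) \<inter> (if i < m then {..<a (Suc i)} else UNIV)"
    by (auto simp: I_def)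
  then have "open I" by auto
  moreover have "x \<in> I" using iJ upper by (auto simp: I_def J_def)
  moreover have "i \<le> m" using iJ by (auto simp: J_def)
  then have "continuous_on I g"
    using g unfolding piecewise_uniformly_continuous_def I_def
    by (blast intro: uniformly_continuous_imp_continuous)
  ultimately show ?thesis by (simp add: continuous_on_eq_continuous_at)
qed

text \<open>The bound is on \<open>b\<close>, the drift whose equation is known: it makes
  \<open>X - z\<close> Lipschitz, so \<open>X\<close> is outside \<open>S\<close> at almost all
  times. The new drift may be unbounded; its integrability is inherited from agreement almost
  everywhere.\<close>

lemma drift_change_along_path:
  fixes b b' :: "real \<Rightarrow> real \<Rightarrow> real"
  assumes z: "null_lipschitz_sets T z" "continuous_on {0..T} z" and T: "0 \<le> T"
    and int: "set_integrable lborel {0..T} (\<lambda>s. b s (X s))"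
    and X: "\<And>t. t \<in> {0..T} \<Longrightarrow> X t = x0 + (LBINT s:{0..t}. b s (X s)) + z t"
    and K: "\<And>s x. s \<in> {0..T} \<Longrightarrow> \<bar>b s x\<bar> \<le> K"
    and b': "drift_measurable T b'" and S: "countable S"
    and eq: "\<And>s x. s \<in> {0..T} \<Longrightarrow> x \<notin> S \<Longrightarrow> b s x = b' s x"
  shows "set_integrable lborel {0..T} (\<lambda>s. b' s (X s))"
    and "t \<in> {0..T} \<Longrightarrow> X t = x0 + (LBINT s:{0..t}. b' s (X s)) + z t"
proof -
  have "continuous_on {0..T} (\<lambda>t. x0 + (LBINT s:{0..t}. b s (X s)) + z t)"
    by (intro continuous_intros continuous_on_LBINT int z)
  then have cX: "continuous_on {0..T} X" by (subst continuous_on_cong[OF refl X])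
  have "{t \<in> {0..T}. X t = a} \<in> null_sets lborel" for a
  proof (rule level_set_null[OF z(1) cX], intro ballI)
    fix s t assume st: "s \<in> {0..T}" "t \<in> {0..T}"
    show "\<bar>(X t - z t) - (X s - z s)\<bar> \<le> K * \<bar>t - s\<bar>"
      using LBINT_diff_le[OF int _ _ _ K, of s t] LBINT_diff_le[OF int _ _ _ K, of t s] st X[OF st(1)] X[OF st(2)]
      by (cases "s \<le> t") (auto simp: abs_minus_commute)
  qed
  then have "(\<Union>a\<in>S. {t \<in> {0..T}. X t = a}) \<in> null_sets lborel"
    using S by (intro null_sets_UN') auto
  then have off: "AE s in lborel. s \<in> {0..T} \<longrightarrow> X s \<notin> S"
    by (rule AE_I') auto
  have ae: "AE s in lborel. indicator {0..t} s *\<^sub>R b s (X s) = indicator {0..t} s *\<^sub>R b' s (X s)"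
    if "t \<in> {0..T}" for t
    using off by (rule eventually_mono) (use that eq in \<open>auto simp: indicator_def\<close>)
  have "set_borel_measurable lborel {0..T} (\<lambda>s. b' (max 0 (min T s)) (X s))"
    by (rule set_borel_measurable_along_path[OF drift_measurable_clamp[OF b' T] cX])
  also have "(\<lambda>s. indicator {0..T} s *\<^sub>R b' (max 0 (min T s)) (X s)) = (\<lambda>s. indicator {0..T} s *\<^sub>R b' s (X s))"
    by (auto simp: indicator_def)
  then have "set_borel_measurable lborel {0..T} (\<lambda>s. b' (max 0 (min T s)) (X s))
    = set_borel_measurable lborel {0..T} (\<lambda>s. b' s (X s))"
    unfolding set_borel_measurable_def by simp
  finally have mb': "(\<lambda>s. indicator {0..T} s *\<^sub>R b' s (X s)) \<in> borel_measurable lborel"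
    by (simp add: set_borel_measurable_def)
  show int': "set_integrable lborel {0..T} (\<lambda>s. b' s (X s))"
    unfolding set_integrable_def
    by (rule integrable_cong_AE_imp[OF int[unfolded set_integrable_def] mb'])
       (use ae[of T] T in \<open>auto elim!: eventually_mono\<close>)
  show "X t = x0 + (LBINT s:{0..t}. b' s (X s)) + z t" if t: "t \<in> {0..T}"
  proof -
    have "(LBINT s:{0..t}. b s (X s)) = (LBINT s:{0..t}. b' s (X s))"
      unfolding set_lebesgue_integral_def
      using set_integrable_initial[OF int t] set_integrable_initial[OF int' t]
      by (intro integral_cong_AE ae t) (auto simp: set_integrable_def)
    then show ?thesis using X[OF t] by simp
  qed
qed

text \<open>\<open>B\<close> supplies the law and through it the irregularity of paths, while
  \<open>wiener\<close> links the noise to the filtration of \<open>W\<close>.\<close>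

locale fbm_driven =
  fixes M :: "'a measure" and W B :: "real \<Rightarrow> 'a \<Rightarrow> real" and T H c :: real
  assumes M: "prob_space M" "complete_measure M"
    and T: "0 < T" and H: "H < 1"
    and W: "brownian_motion M T W"
    and B: "fractional_brownian_motion M T H B"
    and wiener: "\<And>t. t \<in> {0..T} \<Longrightarrow> has_wiener_integral M T W (volterra_kernel H c t) (B t)"
begin

lemma borel_measurable_of_augmented:
  assumes f: "f \<in> borel_measurable (augmented_filtration M W t)" and t: "t \<le> T"
  shows "f \<in> borel_measurable M"
proof -
  have "sets (vimage_algebra (space M) (W s) borel) \<subseteq> sets M" if "s \<in> {0..t}" for s
  proof -
    have "W s \<in> borel_measurable M" using W that t unfolding brownian_motion_def by auto
    then show ?thesis by (auto simp: sets_vimage_algebra2 intro: measurable_sets)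
  qed
  then have "sets (augmented_filtration M W t) \<subseteq> sets M"
    unfolding sets_augmented_filtration
    by (intro sets.sigma_sets_subset Un_least UN_least) (assumption, simp add: null_sets_def subset_eq)
  then show ?thesis using f by (auto simp: measurable_def)
qed

lemma adapted: "t \<in> {0..T} \<Longrightarrow> B t \<in> borel_measurable (augmented_filtration M W t)"
  by (rule wiener_integral_adapted[OF M W _ wiener]) (auto simp: volterra_kernel_def)

lemma AE_continuous: "AE \<omega> in M. continuous_on {0..T} (\<lambda>t. B t \<omega>)"
  using B by (simp add: fractional_brownian_motion_def)

text \<open>Measurability of the Picard iterates is proved for processes with every path continuous.
  Setting the exceptional paths to 0 keeps adaptedness, because the filtration contains all null
  sets.\<close>

lemma continuous_version:
  "\<exists>Z. (\<forall>t\<in>{0..T}. Z t \<in> borel_measurable (augmented_filtration M W t)) \<and>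
    (\<forall>\<omega>. continuous_on {0..T} (\<lambda>t. Z t \<omega>)) \<and> (AE \<omega> in M. \<forall>t\<in>{0..T}. Z t \<omega> = B t \<omega>)"
proof (intro exI conjI ballI allI)
  let ?Z = "\<lambda>t \<omega>. if continuous_on {0..T} (\<lambda>t. B t \<omega>) then B t \<omega> else 0"
  show ZB: "AE \<omega> in M. \<forall>t\<in>{0..T}. ?Z t \<omega> = B t \<omega>"
    using AE_continuous by eventually_elim simp
  show "?Z t \<in> borel_measurable (augmented_filtration M W t)" if t: "t \<in> {0..T}" for t
    by (rule borel_measurable_augmented_filtration_AE[OF M(2) adapted[OF t]])
       (use ZB t in \<open>auto elim!: eventually_mono\<close>)
  show "continuous_on {0..T} (\<lambda>t. ?Z t \<omega>)" for \<omega>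
    by (cases "continuous_on {0..T} (\<lambda>t. B t \<omega>)") simp_all
qed

lemma AE_irregular: "AE \<omega> in M. null_lipschitz_sets T (\<lambda>t. B t \<omega>)"
proof -
  obtain Z where Z: "\<And>t. t \<in> {0..T} \<Longrightarrow> Z t \<in> borel_measurable (augmented_filtration M W t)"
    "\<And>\<omega>. continuous_on {0..T} (\<lambda>t. Z t \<omega>)" "AE \<omega> in M. \<forall>t\<in>{0..T}. Z t \<omega> = B t \<omega>"
    using continuous_version by blast
  have "AE \<omega> in M. null_lipschitz_sets T (\<lambda>t. Z t \<omega>)"
    by (rule AE_null_lipschitz_sets[OF M(1) B T H _ Z(2) Z(3)])
       (auto intro!: borel_measurable_of_augmented Z(1))
  then show ?thesis
    using Z(3)
  proof eventually_elim
    case (elim \<omega>)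
    show ?case
      by (rule null_lipschitz_sets_cong[OF elim(1)]) (use elim(2) in simp)
  qed
qed

lemma strong_solution_change_drift:
  assumes X: "strong_solution M T W B b x0 X"
    and K: "\<And>s x. s \<in> {0..T} \<Longrightarrow> \<bar>b s x\<bar> \<le> K"
    and b': "drift_measurable T b'" and S: "countable S"
    and eq: "\<And>s x. s \<in> {0..T} \<Longrightarrow> x \<notin> S \<Longrightarrow> b s x = b' s x"
  shows "strong_solution M T W B b' x0 X"
proof -
  have "AE \<omega> in M. set_integrable lborel {0..T} (\<lambda>s. b s (X s \<omega>)) \<and>
    (\<forall>t\<in>{0..T}. X t \<omega> = x0 + (LBINT s:{0..t}. b s (X s \<omega>)) + B t \<omega>)"
    using X by (simp add: strong_solution_def)
  then have "AE \<omega> in M. set_integrable lborel {0..T} (\<lambda>s. b' s (X s \<omega>)) \<and>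
    (\<forall>t\<in>{0..T}. X t \<omega> = x0 + (LBINT s:{0..t}. b' s (X s \<omega>)) + B t \<omega>)"
    using AE_irregular AE_continuous
  proof eventually_elim
    case (elim \<omega>)
    note * = drift_change_along_path[where X = "\<lambda>t. X t \<omega>" and z = "\<lambda>t. B t \<omega>", OF elim(2,3) less_imp_le[OF T] conjunct1[OF elim(1)] bspec[OF conjunct2[OF elim(1)]] K b' S eq]
    show ?case by (intro conjI ballI *)
  qed
  then show ?thesis using X by (simp add: strong_solution_def)
qed

lemma strong_solution_constant_drift:
  "strong_solution M T W B (\<lambda>_ _. k) x0 (\<lambda>t \<omega>. x0 + k * t + B t \<omega>)"
  unfolding strong_solution_def
proof (intro conjI ballI AE_I2)
  show "(\<lambda>\<omega>. x0 + k * t + B t \<omega>) \<in> borel_measurable (augmented_filtration M W t)" if "t \<in> {0..T}" for t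
    using adapted[OF that] by simp
  show "set_integrable lborel {0..T} (\<lambda>s. k)"
    by (rule borel_integrable_atLeastAtMost') (rule continuous_on_const)
  show "x0 + k * t + B t \<omega> = x0 + (LBINT s:{0..t}. k) + B t \<omega>" if "t \<in> {0..T}" for t \<omega>
    using that by (simp add: set_lebesgue_integral_def)
qed

lemma constant_drift_unique: "strong_solutions_unique M T W B (\<lambda>_ _. k) x0"
  unfolding strong_solutions_unique_def
proof (intro allI impI, elim conjE)
  fix X Y
  assume "strong_solution M T W B (\<lambda>_ _. k) x0 X" "strong_solution M T W B (\<lambda>_ _. k) x0 Y"
  then have "AE \<omega> in M. \<forall>t\<in>{0..T}. X t \<omega> = x0 + (LBINT s:{0..t}. k) + B t \<omega>"
    "AE \<omega> in M. \<forall>t\<in>{0..T}. Y t \<omega> = x0 + (LBINT s:{0..t}. k) + B t \<omega>"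
    by (simp_all add: strong_solution_def)
  then show "AE \<omega> in M. \<forall>t\<in>{0..T}. X t \<omega> = Y t \<omega>" by eventually_elim simp
qed

lemma strong_solution_exists_linear_growth:
  assumes b: "drift_measurable T b" and S: "countable S"
    and cont: "\<And>t x. t \<in> {0..T} \<Longrightarrow> x \<notin> S \<Longrightarrow> isCont (b t) x"
    and growth: "\<And>t x. t \<in> {0..T} \<Longrightarrow> \<bar>b t x\<bar> \<le> C * (1 + \<bar>x\<bar>)"
  shows "strong_solution_exists M T W B b x0"
proof -
  let ?c = "\<lambda>s. max 0 (min T s)"
  \<comment> \<open>The approximation argument asks for growth and continuity at all real times;
    clamping extends them from \<open>{0..T}\<close> and does not change the equation.\<close>
  define \<beta> where "\<beta> = (\<lambda>s. b (?c s))"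
  have T0: "0 \<le> T" using T by simp
  have c: "?c s \<in> {0..T}" for s using T0 by auto
  have mb: "case_prod \<beta> \<in> borel_measurable (borel \<Otimes>\<^sub>M borel)"
    unfolding \<beta>_def by (rule drift_measurable_clamp[OF b T0])
  have gb: "\<bar>\<beta> s x\<bar> \<le> C * (1 + \<bar>x\<bar>)" for s x
    unfolding \<beta>_def using growth[OF c] .
  have cb: "isCont (\<beta> s) x" if "x \<notin> S" for s x
    unfolding \<beta>_def using cont[OF c that] .
  have C: "0 \<le> C" using gb[of 0 0] by simp
  obtain Z where Z: "\<And>t. t \<in> {0..T} \<Longrightarrow> Z t \<in> borel_measurable (augmented_filtration M W t)"
    "\<And>\<omega>. continuous_on {0..T} (\<lambda>t. Z t \<omega>)" "AE \<omega> in M. \<forall>t\<in>{0..T}. Z t \<omega> = B t \<omega>"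
    using continuous_version by blast
  define w where "w t \<omega> = x0 + Z t \<omega>" for t \<omega>
  define X where "X t \<omega> = lim (\<lambda>n. monotone_scheme \<beta> C (\<lambda>t. w t \<omega>) n t)" for t \<omega>
  have w: "w t \<in> borel_measurable (augmented_filtration M W t)" if "t \<in> {0..T}" for t
    unfolding w_def[abs_def] using Z(1)[OF that] by simp
  have cw: "continuous_on {0..T} (\<lambda>t. w t \<omega>)" for \<omega>
    unfolding w_def by (intro continuous_intros Z(2))
  \<comment> \<open>\<open>X\<close> is an iterated \<open>lim\<close> of Picard iterates, and
    \<open>lim\<close> preserves measurability even where a sequence happens not to
    converge.\<close>
  have mX: "X t \<in> borel_measurable (augmented_filtration M W t)" if t: "t \<in> {0..T}" for t
    unfolding X_def[abs_def] monotone_scheme_def[OF gb C]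
  proof (intro borel_measurable_lim_metric)
    fix n k
    have CL: "C \<le> C + 1 + real n" by simp
    show "(\<lambda>\<omega>. picard (sup_conv \<beta> (C + 1 + real n)) (\<lambda>t. w t \<omega>) k t) \<in> borel_measurable (augmented_filtration M W t)"
      by (rule picard_adapted[OF borel_measurable_sup_conv[OF gb C mb CL] abs_sup_conv_le[OF gb C CL] w cw t])
  qed
  have "AE \<omega> in M. set_integrable lborel {0..T} (\<lambda>s. b s (X s \<omega>)) \<and>
    (\<forall>t\<in>{0..T}. X t \<omega> = x0 + (LBINT s:{0..t}. b s (X s \<omega>)) + B t \<omega>)"
    using AE_irregular Z(3)
  proof eventually_elim
    case (elim \<omega>)
    have "null_lipschitz_sets T (\<lambda>t. w t \<omega>)"
      by (rule null_lipschitz_sets_cong[OF elim(1)]) (use elim(2) in \<open>simp add: w_def\<close>)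
    note lim = monotone_scheme_limit[where w = "\<lambda>t. w t \<omega>", OF gb C mb cw T0 S _ this, folded X_def]
    have eq: "b s x = \<beta> s x" if "s \<in> {0..T}" for s x using that by (simp add: \<beta>_def)
    show ?case
    proof (intro conjI ballI)
      show "set_integrable lborel {0..T} (\<lambda>s. b s (X s \<omega>))"
        using lim(1)[OF cb] by (subst set_integrable_cong[OF refl refl eq])
      fix t assume t: "t \<in> {0..T}"
      have "(LBINT s:{0..t}. b s (X s \<omega>)) = (LBINT s:{0..t}. \<beta> s (X s \<omega>))"
        using t eq by (intro set_lebesgue_integral_cong) auto
      then show "X t \<omega> = x0 + (LBINT s:{0..t}. b s (X s \<omega>)) + B t \<omega>"
        using lim(2)[OF cb t] elim(2) t by (simp add: w_def)
    qed
  qed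
  with mX have "strong_solution M T W B b x0 X" by (simp add: strong_solution_def)
  then show ?thesis unfolding strong_solution_exists_def by blast
qed

text \<open>The noise cancels in the difference of two solutions. Where one is larger, its drift is
  not larger, so the comparison lemma applies in both directions.\<close>

lemma antimono_drift_unique:
  assumes anti: "\<And>t. t \<in> {0..T} \<Longrightarrow> antimono (b t)"
  shows "strong_solutions_unique M T W B b x0"
  unfolding strong_solutions_unique_def
proof (intro allI impI, elim conjE)
  fix X Y assume X: "strong_solution M T W B b x0 X" and Y: "strong_solution M T W B b x0 Y"
  have le: "x t \<le> y t"
    if x: "set_integrable lborel {0..T} (\<lambda>s. b s (x s))" "\<forall>t\<in>{0..T}. x t = x0 + (LBINT s:{0..t}. b s (x s)) + z t"
      and y: "set_integrable lborel {0..T} (\<lambda>s. b s (y s))" "\<forall>t\<in>{0..T}. y t = x0 + (LBINT s:{0..t}. b s (y s)) + z t"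
      and t: "t \<in> {0..T}" for x y z :: "real \<Rightarrow> real" and t
  proof -
    have "x t - y t \<le> 0"
    proof (rule comparison[where L = 1, OF set_integral_diff(1)[OF x(1) y(1)] _ _ _ t])
      fix t assume t: "t \<in> {0..T}"
      show "x t - y t = (LBINT s:{0..t}. b s (x s) - b s (y s))"
        unfolding set_integral_diff(2)[OF set_integrable_initial[OF x(1) t] set_integrable_initial[OF y(1) t]]
        using bspec[OF x(2) t] bspec[OF y(2) t] by linarith
    next
      fix s assume s: "s \<in> {0..T}" and pos: "0 < x s - y s"
      then show "b s (x s) - b s (y s) \<le> 1 * (x s - y s)"
        using antimonoD[OF anti[OF s], of "y s" "x s"] by simp
    qed simp
    then show ?thesis by simp
  qed
  from X Y have "AE \<omega> in M. set_integrable lborel {0..T} (\<lambda>s. b s (X s \<omega>)) \<and>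
      (\<forall>t\<in>{0..T}. X t \<omega> = x0 + (LBINT s:{0..t}. b s (X s \<omega>)) + B t \<omega>)"
    "AE \<omega> in M. set_integrable lborel {0..T} (\<lambda>s. b s (Y s \<omega>)) \<and>
      (\<forall>t\<in>{0..T}. Y t \<omega> = x0 + (LBINT s:{0..t}. b s (Y s \<omega>)) + B t \<omega>)"
    by (simp_all add: strong_solution_def)
  then show "AE \<omega> in M. \<forall>t\<in>{0..T}. X t \<omega> = Y t \<omega>"
  proof eventually_elim
    case (elim \<omega>)
    show ?case
    proof
      fix t assume "t \<in> {0..T}"
      with elim show "X t \<omega> = Y t \<omega>"
        using le[of "\<lambda>t. X t \<omega>" "\<lambda>t. B t \<omega>" "\<lambda>t. Y t \<omega>" t] le[of "\<lambda>t. Y t \<omega>" "\<lambda>t. B t \<omega>" "\<lambda>t. X t \<omega>" t]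
        by (intro antisym) blast+
    qed
  qed
qed

lemma change_drift_exists:
  assumes "strong_solution_exists M T W B b x0"
    and "\<And>s x. s \<in> {0..T} \<Longrightarrow> \<bar>b s x\<bar> \<le> K" and "drift_measurable T b'" and "countable S"
    and "\<And>s x. s \<in> {0..T} \<Longrightarrow> x \<notin> S \<Longrightarrow> b s x = b' s x"
  shows "strong_solution_exists M T W B b' x0"
  using assms(1) strong_solution_change_drift[OF _ assms(2-5)]
  unfolding strong_solution_exists_def by blast

text \<open>Any two solutions for \<open>b\<close> are carried over to \<open>b'\<close>, where they
  must coincide. So the bound concerns the drift whose uniqueness is claimed, in contrast to
  existence, where it concerns the drift already solved.\<close>

lemma change_drift_unique:
  assumes "strong_solutions_unique M T W B b' x0"
    and "\<And>s x. s \<in> {0..T} \<Longrightarrow> \<bar>b s x\<bar> \<le> K" and "drift_measurable T b'" and "countable S"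
    and "\<And>s x. s \<in> {0..T} \<Longrightarrow> x \<notin> S \<Longrightarrow> b s x = b' s x"
  shows "strong_solutions_unique M T W B b x0"
  using assms(1) strong_solution_change_drift[OF _ assms(2-5)]
  unfolding strong_solutions_unique_def by blast

end

theorem theorem1p5:
  fixes M :: "'a measure" and W B :: "real \<Rightarrow> 'a \<Rightarrow> real"
    and T H c x0 :: real and b :: "real \<Rightarrow> real \<Rightarrow> real"
  assumes "prob_space M" and "complete_measure M"
    and "0 < T" and "1 / 2 < H" and "H < 1" and "0 < c"
    and "brownian_motion M T W"
    and "fractional_brownian_motion M T H B"
    and "\<forall>t\<in>{0..T}. has_wiener_integral M T W (volterra_kernel H c t) (B t)"
    and "drift_measurable T b"
  shows
    "(\<forall>(m :: nat) (a :: nat \<Rightarrow> real).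
        strict_mono_on {1..m} a \<and>
        (\<forall>t\<in>{0..T}. piecewise_uniformly_continuous m a (b t)) \<and>
        (\<exists>C. \<forall>t\<in>{0..T}. \<forall>x. \<bar>b t x\<bar> \<le> C * (1 + \<bar>x\<bar>)) \<longrightarrow>
        strong_solution_exists M T W B b x0 \<and>
        ((\<forall>t\<in>{0..T}. antimono (b t)) \<longrightarrow> strong_solutions_unique M T W B b x0))
     \<and>
     (\<forall>(m :: nat) (N :: nat \<Rightarrow> real set) (f :: nat \<Rightarrow> real \<Rightarrow> real) (q :: nat \<Rightarrow> ennreal).
        (\<forall>i\<in>{1..m}. countable (N i) \<and> 1 < q i \<and> in_Lq (q i) (f i)) \<and>
        (\<forall>t\<in>{0..T}. \<forall>x. b t x = (\<Sum>i=1..m. f i x * indicator (N i) x)) \<longrightarrow>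
        strong_solution_exists M T W B b x0 \<and>
        ((\<forall>i\<in>{1..m}. \<exists>K. \<forall>x. \<bar>f i x\<bar> \<le> K) \<longrightarrow> strong_solutions_unique M T W B b x0))
     \<and>
     (\<forall>N :: real set. countable (UNIV - N) \<longrightarrow>
        ((\<forall>t\<in>{0..T}. \<forall>x. b t x = indicator N x) \<longrightarrow>
           strong_solution_exists M T W B b x0 \<and> strong_solutions_unique M T W B b x0) \<and>
        (\<forall>b' :: real \<Rightarrow> real \<Rightarrow> real.
           drift_measurable T b' \<and>
           (\<exists>K. \<forall>t\<in>{0..T}. \<forall>x. \<bar>b' t x\<bar> \<le> K) \<and>
           strong_solution_exists M T W B b' x0 \<and> strong_solutions_unique M T W B b' x0 \<and>
           (\<forall>t\<in>{0..T}. \<forall>x. b t x = b' t x * indicator N x) \<longrightarrow>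
           strong_solution_exists M T W B b x0 \<and> strong_solutions_unique M T W B b x0))"
proof -
  interpret fbm_driven M W B T H c
    by (rule fbm_driven.intro[OF assms(1,2,3,5,7,8) bspec[OF assms(9)]])
  note b = \<open>drift_measurable T b\<close>
  show ?thesis
  proof (intro conjI allI impI; (elim conjE)?)
    fix m :: nat and a :: "nat \<Rightarrow> real"
    assume pw: "\<forall>t\<in>{0..T}. piecewise_uniformly_continuous m a (b t)"
      and "\<exists>C. \<forall>t\<in>{0..T}. \<forall>x. \<bar>b t x\<bar> \<le> C * (1 + \<bar>x\<bar>)"
    then obtain C where C: "\<And>t x. t \<in> {0..T} \<Longrightarrow> \<bar>b t x\<bar> \<le> C * (1 + \<bar>x\<bar>)" by blast
    show "strong_solution_exists M T W B b x0"
    proof (rule strong_solution_exists_linear_growth[OF b _ _ C])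
      show "countable (a ` {1..m})" by simp
      show "isCont (b t) x" if "t \<in> {0..T}" "x \<notin> a ` {1..m}" for t x
        using pw that by (blast intro: piecewise_uniformly_continuous_isCont)
    qed
  next
    assume "\<forall>t\<in>{0..T}. antimono (b t)"
    then show "strong_solutions_unique M T W B b x0" by (blast intro: antimono_drift_unique)
  next
    fix m :: nat and N :: "nat \<Rightarrow> real set" and f :: "nat \<Rightarrow> real \<Rightarrow> real" and q :: "nat \<Rightarrow> ennreal"
    assume N: "\<forall>i\<in>{1..m}. countable (N i) \<and> 1 < q i \<and> in_Lq (q i) (f i)"
      and bf: "\<forall>t\<in>{0..T}. \<forall>x. b t x = (\<Sum>i=1..m. f i x * indicator (N i) x)"
    have S: "countable (\<Union>i\<in>{1..m}. N i)" using N by (intro countable_UN) auto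
    have b0: "b t x = 0" if "t \<in> {0..T}" "x \<notin> (\<Union>i\<in>{1..m}. N i)" for t x
      using bf that by (auto intro!: sum.neutral)
    \<comment> \<open>For zero drift \<open>x0 + B\<close> is a solution. Transferring it away from
      the bounded drift 0 reaches \<open>b\<close> even when the functions \<open>f i\<close> are
      unbounded.\<close>
    have zero: "strong_solution_exists M T W B (\<lambda>_ _. 0) x0"
      using strong_solution_constant_drift unfolding strong_solution_exists_def by blast
    show "strong_solution_exists M T W B b x0"
      by (rule change_drift_exists[OF zero _ b S, where K = 0]) (simp_all add: b0)
    assume "\<forall>i\<in>{1..m}. \<exists>K. \<forall>x. \<bar>f i x\<bar> \<le> K"
    then obtain K where K: "\<And>i x. i \<in> {1..m} \<Longrightarrow> \<bar>f i x\<bar> \<le> K i" by metis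
    have Kb: "\<bar>b t x\<bar> \<le> (\<Sum>i=1..m. K i)" if t: "t \<in> {0..T}" for t x
    proof -
      have "\<bar>b t x\<bar> \<le> (\<Sum>i=1..m. \<bar>f i x * indicator (N i) x\<bar>)"
        using bf t by (simp only: sum_abs)
      also have "\<dots> \<le> (\<Sum>i=1..m. K i)"
      proof (rule sum_mono)
        fix i assume "i \<in> {1..m}"
        then have "\<bar>f i x\<bar> \<le> K i" by (rule K)
        then show "\<bar>f i x * indicator (N i) x\<bar> \<le> K i"
          using abs_ge_zero[of "f i x"] by (auto simp: indicator_def)
      qed
      finally show ?thesis .
    qed
    \<comment> \<open>Here solutions travel from \<open>b\<close> to the zero drift, so boundedness
      of the functions \<open>f i\<close> enters through \<open>Kb\<close>.\<close>
    show "strong_solutions_unique M T W B b x0"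
      by (rule change_drift_unique[OF constant_drift_unique Kb drift_measurable_const S b0])
  next
    fix N :: "real set"
    assume N: "countable (UNIV - N)" and bN: "\<forall>t\<in>{0..T}. \<forall>x. b t x = indicator N x"
    have one: "strong_solution_exists M T W B (\<lambda>_ _. 1) x0"
      using strong_solution_constant_drift unfolding strong_solution_exists_def by blast
    have eq: "b t x = 1" if "t \<in> {0..T}" "x \<notin> UNIV - N" for t x using bN that by simp
    show "strong_solution_exists M T W B b x0"
      by (rule change_drift_exists[OF one _ b N, where K = 1]) (simp_all add: bN)
    show "strong_solutions_unique M T W B b x0"
      by (rule change_drift_unique[OF constant_drift_unique _ drift_measurable_const N eq, where K = 1])
         (use bN in \<open>simp_all add: indicator_def\<close>)
  next
    fix N :: "real set" and b' :: "real \<Rightarrow> real \<Rightarrow> real"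
    assume N: "countable (UNIV - N)" and b': "drift_measurable T b'"
      and "\<exists>K. \<forall>t\<in>{0..T}. \<forall>x. \<bar>b' t x\<bar> \<le> K"
      and ex: "strong_solution_exists M T W B b' x0" and un: "strong_solutions_unique M T W B b' x0"
      and bN: "\<forall>t\<in>{0..T}. \<forall>x. b t x = b' t x * indicator N x"
    then obtain K where K: "\<And>t x. t \<in> {0..T} \<Longrightarrow> \<bar>b' t x\<bar> \<le> K" by blast
    have eq: "b t x = b' t x" if "t \<in> {0..T}" "x \<notin> UNIV - N" for t x using bN that by simp
    \<comment> \<open>The bound on \<open>b'\<close> is inherited by \<open>b\<close>, so solutions
      can be transferred both ways: towards \<open>b\<close> for existence, towards
      \<open>b'\<close> for uniqueness.\<close>
    have Kb: "\<bar>b t x\<bar> \<le> K" if "t \<in> {0..T}" for t x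
      using K[OF that, of x] bN that by (auto simp: indicator_def)
    show "strong_solution_exists M T W B b x0"
      by (rule change_drift_exists[OF ex K b N eq[symmetric]])
    show "strong_solutions_unique M T W B b x0"
      by (rule change_drift_unique[OF un Kb b' N eq])
  qed
qed

end
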